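(* Let $(G,E)$ be a countable self-similar directed graph and consider the corresponding Exel–Pardo groupoid $\mathcal G:=\mathcal G_{G,E}$ acting on $\partial E$. Then there is a unique bijection $$\pi\colon\mathcal M(G,E)\sqcup(G\backslash\mathcal{BV}(G,E))\to(\mathcal G\backslash\partial E)^\sim$$ satisfying the following properties: (i) if $L\in\mathcal L(G,E)$, then $\pi(L)=\mathcal Q(x_L)$; (ii) if $M\in\mathcal M_0(G,E)$, that is, there is a minimal element $v\in M$ such that $vE^1M=\emptyset$, then $v\in E^{\mathrm{sing}}$ and $\pi(M)=\mathcal Q(v)$; (iii) if $M\in\mathcal M_\infty(G,E)=\mathcal M_\gamma(G,E)\setminus\mathcal M_0(G,E)$, then $\pi(M)=\mathcal Q(x)$ for any path $x\in E^\infty$ such that $\mathrm M_G(x)=M$; moreover, such a path $x$ can be chosen to lie in $E^\infty\cap A_{G,E}$; (iv) if $v\in\mathcal{BV}(G,E)$, then $\pi(G\cdot v)=\mathcal Q(v)$. The image of the quasi-orbit $\mathcal Q(x)\in(\mathcal G\backslash\partial E)^\sim$ of a path $x\in\partial E$ under the inverse map $\pi^{-1}$ is described as follows: if $x\in\partial E\cap E^*$ and $s(x)$ is a $G$-breaking vertex, then $\pi^{-1}(\mathcal Q(x))=G\cdot s(x)\in G\backslash\mathcal{BV}(G,E)$; otherwise $\pi^{-1}(\mathcal Q(x))=\mathrm M_G(x)\in\mathcal M(G,E)$.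
   Context: Graphs. $E$ is a directed graph with vertex set $E^0$, edge set $E^1$ and maps $r,s\colon E^1\to E^0$. $E^*$ is the set of finite paths: vertices (length $0$) and words $e_1\cdots e_n$ of edges with $s(e_i)=r(e_{i+1})$, with $r(e_1\cdots e_n)=r(e_1)$, $s(e_1\cdots e_n)=s(e_n)$; $E^\infty$ is the set of infinite paths $x_1x_2\cdots$, $s(x_i)=r(x_{i+1})$. For sets of paths, $AB$ is the set of concatenations; so $vE^*w$ is the set of finite paths with range $v$ and source $w$, $vE^1M=\{e\in E^1:r(e)=v,\ s(e)\in M\}$. $E^{\mathrm{sing}}=\{v:|vE^1|\in\{0,\infty\}\}$ (singular vertices); other vertices are regular. $\partial E=E^\infty\cup\{\alpha\in E^*:s(\alpha)\in E^{\mathrm{sing}}\}$, with the topology having as basis the sets $Z(\alpha)\setminus\bigcup_{\beta\in F}Z(\alpha\beta)$, $\alpha\in E^*$, $F\subset s(\alpha)E^*$ finite, where $Z(\alpha)$ is the set of boundary paths with initial segment $\alpha$. $\sigma$ removes the first edge of a path of length $\ge1$. Self-similarity. $(G,E)$ is a self-similar graph if the discrete group $G$ acts on the set $E^*$ preserving length and commuting with $r$ and $s$, and we are given a map $G\times E^*\to G$, $(g,\mu)\mapsto g|_\mu$, with: $g\cdot(\mu\nu)=(g\cdot\mu)(g|_\mu\cdot\nu)$ and $g|_{\mu\nu}=(g|_\mu)|_\nu$ when $s(\mu)=r(\nu)$; $(gh)|_\mu=g|_{h\cdot\mu}h|_\mu$; $g|_v=g$ for $v\in E^0$. Countable means $G$,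 $E^0$, $E^1$ are countable. $G$ acts on $\partial E$ by homeomorphisms so that the initial segment of $g\cdot x$ of length $n$ is $g\cdot(x_1\cdots x_n)$. Orbits. Only the orbit structure of $\mathcal G=\mathcal G_{G,E}$ on its unit space $\partial E$ matters: $[x]_{\mathcal G}$ is the smallest set containing $x$ and invariant under $G$, $\sigma$ and $\sigma^{-1}$, i.e. the set of paths $\mu(g\cdot\sigma^n(x))$ with $n\ge0$, $\sigma^n(x)$ defined, $g\in G$, $\mu\in E^*$, $s(\mu)=r(g\cdot\sigma^n(x))$. The quasi-orbit space $(\mathcal G\backslash\partial E)^\sim$ is the quotient of $\partial E$ by $x\sim y$ iff $\overline{[x]}_{\mathcal G}=\overline{[y]}_{\mathcal G}$, and $\mathcal Q(x)$ is the class of $x$. Tails. $v\ge w$ means $vE^*w\ne\emptyset$; $v\sim w$ means $v\ge w$ and $w\ge v$. A maximal $G$-tail is a nonempty $G$-invariant $M\subset E^0$ such that: if $v\ge w$ and $w\in M$ then $v\in M$; if $v\in M$ is regular then $vE^1M\ne\emptyset$; for all $v,w\in M$ there are $g\in G$, $u\in M$ with $v\ge u$, $w\ge g\cdot u$. $\mathcal M(G,E)$ is the set of maximal $G$-tails. An element $v\in M$ is minimal if every $w\in M$ with $w\le v$ satisfies $w\sim v$. $\mathrm M_G(x)=\{r(y):y\in[x]_{\mathcal G}\}$, which is a maximal $G$-tail for every $x\in\partial E$. $A_{G,E}$ is the set of $x\in\partial E$ such that $\sigma^n(x)=g\cdot\sigma^m(x)$ with $g\in G$, $n,m\in\mathbb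 Z_+$ implies $n=m$. A path $x\in E^\infty$ with vertices in $M$ has no entry in $M$ if $r(x_n)E^1M=\{x_n\}$ for all $n\ge1$. $\mathcal L(G,E)$ is the set of $M\in\mathcal M(G,E)$ for which there is a path in $E^\infty\setminus A_{G,E}$ with vertices in $M$ and no entry in $M$; $\mathcal M_\gamma(G,E)=\mathcal M(G,E)\setminus\mathcal L(G,E)$. For $L\in\mathcal L(G,E)$, $x_L\in E^\infty\setminus A_{G,E}$ is a fixed path with vertices in $L$ and no entry in $L$ (its $\mathcal G$-orbit depends only on $L$). $\mathcal M_0(G,E)$ is the set of maximal $G$-tails $M$ containing a minimal element $v$ with $vE^1M=\emptyset$ (a subset of $\mathcal M_\gamma(G,E)$). A vertex $v\in E^{\mathrm{sing}}$ is a $G$-breaking vertex if the set $\{e\in E^1:r(e)=v,\ s(e)\ge g\cdot v\text{ for some }g\in G\}$ is finite and nonempty; $\mathcal{BV}(G,E)$ is the ($G$-invariant) set of these. *)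

theory Defs
  imports
    "Graph_Theory.Arc_Walk"
    "HOL-Algebra.Group_Action"
    "HOL-Library.Stream"
    "HOL-Library.Extended_Nat"
    "HOL-Analysis.Function_Topology"
begin

section \<open>Paths\<close>

text \<open>
  Paths are words \<open>e\<^sub>1 e\<^sub>2 \<dots>\<close> with \<open>s(e\<^sub>i) = r(e\<^sub>i\<^sub>+\<^sub>1)\<close>.  Read from left to right such a word is
  a walk that traverses each edge \<open>e\<close> from its range \<open>r(e)\<close> to its source \<open>s(e)\<close>.  To be able to
  use the walks of the digraph library we therefore store the range of an edge in the field
  \<open>tail\<close> and its source in the field \<open>head\<close>; then \<open>pre_digraph.awalk E v es w\<close> says that \<open>es\<close>
  is a path with range \<open>v\<close> and source \<open>w\<close>.
\<close>

abbreviation rng :: "('v, 'e) pre_digraph \<Rightarrow> 'e \<Rightarrow> 'v" where "rng \<equiv> tail"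
abbreviation src :: "('v, 'e) pre_digraph \<Rightarrow> 'e \<Rightarrow> 'v" where "src \<equiv> head"

text \<open>
  A finite path is the pair of its range and its word of edges: the vertex \<open>v\<close> is \<open>(v, [])\<close>, and
  \<open>e\<^sub>1\<dots>e\<^sub>n\<close> with \<open>n \<ge> 1\<close> is \<open>(r(e\<^sub>1), [e\<^sub>1, \<dots>, e\<^sub>n])\<close>.
\<close>

type_synonym ('v, 'e) fpath = "'v \<times> 'e list"

definition finite_paths :: "('v, 'e) pre_digraph \<Rightarrow> ('v, 'e) fpath set" where
  "finite_paths E = {(v, es) | v es. \<exists>w. pre_digraph.awalk E v es w}"

abbreviation vertex :: "'v \<Rightarrow> ('v, 'e) fpath" where
  "vertex v \<equiv> (v, [])"

definition frange :: "('v, 'e) fpath \<Rightarrow> 'v" where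
  "frange p = fst p"

definition fsource :: "('v, 'e) pre_digraph \<Rightarrow> ('v, 'e) fpath \<Rightarrow> 'v" where
  "fsource E p = pre_digraph.awlast E (fst p) (snd p)"

definition flength :: "('v, 'e) fpath \<Rightarrow> nat" where
  "flength p = length (snd p)"

text \<open>Only meaningful if \<open>fsource E p = frange q\<close>.\<close>
definition fconcat :: "('v, 'e) fpath \<Rightarrow> ('v, 'e) fpath \<Rightarrow> ('v, 'e) fpath" where
  "fconcat p q = (fst p, snd p @ snd q)"

text \<open>\<open>x !! n\<close> is the edge \<open>x\<^sub>n\<^sub>+\<^sub>1\<close>.\<close>
definition infinite_paths :: "('v, 'e) pre_digraph \<Rightarrow> 'e stream set" where
  "infinite_paths E = {x. \<forall>n. x !! n \<in> arcs E \<and> src E (x !! n) = rng E (x !! Suc n)}"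

text \<open>\<open>v \<ge> w\<close>, i.e. \<open>vE\<^sup>*w \<noteq> {}\<close>.\<close>
definition path_ge :: "('v, 'e) pre_digraph \<Rightarrow> 'v \<Rightarrow> 'v \<Rightarrow> bool" where
  "path_ge E v w \<longleftrightarrow> (\<exists>p \<in> finite_paths E. frange p = v \<and> fsource E p = w)"

definition path_equiv :: "('v, 'e) pre_digraph \<Rightarrow> 'v \<Rightarrow> 'v \<Rightarrow> bool" where
  "path_equiv E v w \<longleftrightarrow> path_ge E v w \<and> path_ge E w v"

text \<open>\<open>vE\<^sup>1M\<close>\<close>
definition edges_into_from :: "('v, 'e) pre_digraph \<Rightarrow> 'v \<Rightarrow> 'v set \<Rightarrow> 'e set" where
  "edges_into_from E v M = {e \<in> arcs E. rng E e = v \<and> src E e \<in> M}"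

definition singular_vertices :: "('v, 'e) pre_digraph \<Rightarrow> 'v set" where
  "singular_vertices E =
     {v \<in> verts E. {e \<in> arcs E. rng E e = v} = {} \<or> infinite {e \<in> arcs E. rng E e = v}}"


section \<open>The boundary path space\<close>

datatype ('v, 'e) path = FinPath "('v, 'e) fpath" | InfPath "'e stream"

fun prange :: "('v, 'e) pre_digraph \<Rightarrow> ('v, 'e) path \<Rightarrow> 'v" where
  "prange E (FinPath p) = frange p"
| "prange E (InfPath x) = rng E (shd x)"

fun plength :: "('v, 'e) path \<Rightarrow> enat" where
  "plength (FinPath p) = enat (flength p)"
| "plength (InfPath x) = \<infinity>"

fun pconcat :: "('v, 'e) fpath \<Rightarrow> ('v, 'e) path \<Rightarrow> ('v, 'e) path" where
  "pconcat m (FinPath p) = FinPath (fconcat m p)"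
| "pconcat m (InfPath x) = InfPath (snd m @- x)"

text \<open>\<open>\<sigma>\<close>, only meaningful on paths of length at least \<open>1\<close>; thus \<open>\<sigma>\<^sup>n(x)\<close> is defined if and only if
  \<open>enat n \<le> plength x\<close>.\<close>
fun shift1 :: "('v, 'e) pre_digraph \<Rightarrow> ('v, 'e) path \<Rightarrow> ('v, 'e) path" where
  "shift1 E (FinPath p) = FinPath (src E (hd (snd p)), tl (snd p))"
| "shift1 E (InfPath x) = InfPath (stl x)"

definition boundary :: "('v, 'e) pre_digraph \<Rightarrow> ('v, 'e) path set" where
  "boundary E = InfPath ` infinite_paths E \<union>
     FinPath ` {p \<in> finite_paths E. fsource E p \<in> singular_vertices E}"

definition cylinder :: "('v, 'e) pre_digraph \<Rightarrow> ('v, 'e) fpath \<Rightarrow> ('v, 'e) path set" where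
  "cylinder E a = {pconcat a y | y. y \<in> boundary E \<and> prange E y = fsource E a}"

text \<open>
  The generating sets form a basis of a topology on \<open>boundary E\<close>, so using them as a subbasis gives
  the topology with this basis.
\<close>
definition boundary_topology :: "('v, 'e) pre_digraph \<Rightarrow> ('v, 'e) path topology" where
  "boundary_topology E = topology_generated_by
     {cylinder E a - (\<Union>b\<in>F. cylinder E (fconcat a b)) | a F.
        a \<in> finite_paths E \<and> finite F \<and> F \<subseteq> {b \<in> finite_paths E. frange b = fsource E a}}"


section \<open>Self-similar graphs\<close>

text \<open>
  The condition \<open>compose_defined\<close> is the implicit requirement that the product on the right-hand
  side of \<open>g\<cdot>(\<mu>\<nu>) = (g\<cdot>\<mu>)(g|\<^sub>\<mu>\<cdot>\<nu>)\<close> is a product of composable paths, which \<open>fconcat\<close> does not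
  check.
\<close>

locale self_similar_graph = wf_digraph E + group G
  for E :: "('v, 'e) pre_digraph" and G :: "('g, 'b) monoid_scheme" +
  fixes act :: "'g \<Rightarrow> ('v, 'e) fpath \<Rightarrow> ('v, 'e) fpath"
    and restr :: "'g \<Rightarrow> ('v, 'e) fpath \<Rightarrow> 'g"
  assumes action: "group_action G (finite_paths E) act"
    and act_length:
      "\<lbrakk>g \<in> carrier G; m \<in> finite_paths E\<rbrakk> \<Longrightarrow> flength (act g m) = flength m"
    and act_range:
      "\<lbrakk>g \<in> carrier G; m \<in> finite_paths E\<rbrakk> \<Longrightarrow>
        vertex (frange (act g m)) = act g (vertex (frange m))"
    and act_source:
      "\<lbrakk>g \<in> carrier G; m \<in> finite_paths E\<rbrakk> \<Longrightarrow>
        vertex (fsource E (act g m)) = act g (vertex (fsource E m))"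
    and restr_closed:
      "\<lbrakk>g \<in> carrier G; m \<in> finite_paths E\<rbrakk> \<Longrightarrow> restr g m \<in> carrier G"
    and compose_defined:
      "\<lbrakk>g \<in> carrier G; m \<in> finite_paths E; n \<in> finite_paths E; fsource E m = frange n\<rbrakk> \<Longrightarrow>
        fsource E (act g m) = frange (act (restr g m) n)"
    and act_concat:
      "\<lbrakk>g \<in> carrier G; m \<in> finite_paths E; n \<in> finite_paths E; fsource E m = frange n\<rbrakk> \<Longrightarrow>
        act g (fconcat m n) = fconcat (act g m) (act (restr g m) n)"
    and restr_concat:
      "\<lbrakk>g \<in> carrier G; m \<in> finite_paths E; n \<in> finite_paths E; fsource E m = frange n\<rbrakk> \<Longrightarrow>
        restr g (fconcat m n) = restr (restr g m) n"
    and restr_mult: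
      "\<lbrakk>g \<in> carrier G; h \<in> carrier G; m \<in> finite_paths E\<rbrakk> \<Longrightarrow>
        restr (g \<otimes>\<^bsub>G\<^esub> h) m = restr g (act h m) \<otimes>\<^bsub>G\<^esub> restr h m"
    and restr_vertex:
      "\<lbrakk>g \<in> carrier G; v \<in> verts E\<rbrakk> \<Longrightarrow> restr g (vertex v) = g"

locale countable_self_similar_graph = self_similar_graph +
  assumes "countable (carrier G)" and "countable (verts E)" and "countable (arcs E)"

definition vact :: "('g \<Rightarrow> ('v, 'e) fpath \<Rightarrow> ('v, 'e) fpath) \<Rightarrow> 'g \<Rightarrow> 'v \<Rightarrow> 'v" where
  "vact act g v = frange (act g (vertex v))"

text \<open>
  On an infinite path \<open>x\<close>, the \<open>n\<close>-th edge of \<open>g\<cdot>x\<close> is the last edge of \<open>g\<cdot>(x\<^sub>1\<dots>x\<^sub>n)\<close>, so that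
  the initial segment of \<open>g\<cdot>x\<close> of length \<open>n\<close> is \<open>g\<cdot>(x\<^sub>1\<dots>x\<^sub>n)\<close>.
\<close>
fun pact :: "('v, 'e) pre_digraph \<Rightarrow> ('g \<Rightarrow> ('v, 'e) fpath \<Rightarrow> ('v, 'e) fpath) \<Rightarrow>
    'g \<Rightarrow> ('v, 'e) path \<Rightarrow> ('v, 'e) path" where
  "pact E act g (FinPath p) = FinPath (act g p)"
| "pact E act g (InfPath x) =
     InfPath (smap (\<lambda>n. last (snd (act g (rng E (shd x), stake (Suc n) x)))) nats)"


section \<open>Orbits and quasi-orbits\<close>

definition grpd_orbit :: "('v, 'e) pre_digraph \<Rightarrow> ('g, 'b) monoid_scheme \<Rightarrow>
    ('g \<Rightarrow> ('v, 'e) fpath \<Rightarrow> ('v, 'e) fpath) \<Rightarrow> ('v, 'e) path \<Rightarrow> ('v, 'e) path set" where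
  "grpd_orbit E G act x =
     {pconcat m (pact E act g ((shift1 E ^^ n) x)) | m g n.
        enat n \<le> plength x \<and> g \<in> carrier G \<and> m \<in> finite_paths E \<and>
        fsource E m = prange E (pact E act g ((shift1 E ^^ n) x))}"

definition quasi_orbit_rel :: "('v, 'e) pre_digraph \<Rightarrow> ('g, 'b) monoid_scheme \<Rightarrow>
    ('g \<Rightarrow> ('v, 'e) fpath \<Rightarrow> ('v, 'e) fpath) \<Rightarrow> (('v, 'e) path \<times> ('v, 'e) path) set" where
  "quasi_orbit_rel E G act =
     {(x, y). x \<in> boundary E \<and> y \<in> boundary E \<and>
        boundary_topology E closure_of grpd_orbit E G act x =
        boundary_topology E closure_of grpd_orbit E G act y}"

definition quasi_orbit_space :: "('v, 'e) pre_digraph \<Rightarrow> ('g, 'b) monoid_scheme \<Rightarrow>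
    ('g \<Rightarrow> ('v, 'e) fpath \<Rightarrow> ('v, 'e) fpath) \<Rightarrow> ('v, 'e) path set set" where
  "quasi_orbit_space E G act = boundary E // quasi_orbit_rel E G act"

definition quasi_orbit :: "('v, 'e) pre_digraph \<Rightarrow> ('g, 'b) monoid_scheme \<Rightarrow>
    ('g \<Rightarrow> ('v, 'e) fpath \<Rightarrow> ('v, 'e) fpath) \<Rightarrow> ('v, 'e) path \<Rightarrow> ('v, 'e) path set" where
  "quasi_orbit E G act x = quasi_orbit_rel E G act `` {x}"

text \<open>The set \<open>A\<close> of paths \<open>x\<close> such that \<open>\<sigma>\<^sup>n(x) = g\<cdot>\<sigma>\<^sup>m(x)\<close> implies \<open>n = m\<close>.\<close>
definition aperiodic_paths :: "('v, 'e) pre_digraph \<Rightarrow> ('g, 'b) monoid_scheme \<Rightarrow>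
    ('g \<Rightarrow> ('v, 'e) fpath \<Rightarrow> ('v, 'e) fpath) \<Rightarrow> ('v, 'e) path set" where
  "aperiodic_paths E G act =
     {x \<in> boundary E. \<forall>g \<in> carrier G. \<forall>n m.
        enat n \<le> plength x \<longrightarrow> enat m \<le> plength x \<longrightarrow>
        (shift1 E ^^ n) x = pact E act g ((shift1 E ^^ m) x) \<longrightarrow> n = m}"


section \<open>Maximal tails and breaking vertices\<close>

definition maximal_tails :: "('v, 'e) pre_digraph \<Rightarrow> ('g, 'b) monoid_scheme \<Rightarrow>
    ('g \<Rightarrow> ('v, 'e) fpath \<Rightarrow> ('v, 'e) fpath) \<Rightarrow> 'v set set" where
  "maximal_tails E G act =
     {M. M \<noteq> {} \<and> M \<subseteq> verts E \<and>
         (\<forall>g \<in> carrier G. \<forall>v \<in> M. vact act g v \<in> M) \<and>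
         (\<forall>v w. path_ge E v w \<longrightarrow> w \<in> M \<longrightarrow> v \<in> M) \<and>
         (\<forall>v \<in> M. v \<notin> singular_vertices E \<longrightarrow> edges_into_from E v M \<noteq> {}) \<and>
         (\<forall>v \<in> M. \<forall>w \<in> M. \<exists>g \<in> carrier G. \<exists>u \<in> M.
            path_ge E v u \<and> path_ge E w (vact act g u))}"

definition minimal_in :: "('v, 'e) pre_digraph \<Rightarrow> 'v set \<Rightarrow> 'v \<Rightarrow> bool" where
  "minimal_in E M v \<longleftrightarrow> v \<in> M \<and> (\<forall>w \<in> M. path_ge E v w \<longrightarrow> path_equiv E w v)"

text \<open>\<open>M\<^sub>G(x)\<close>\<close>
definition tail_of :: "('v, 'e) pre_digraph \<Rightarrow> ('g, 'b) monoid_scheme \<Rightarrow>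
    ('g \<Rightarrow> ('v, 'e) fpath \<Rightarrow> ('v, 'e) fpath) \<Rightarrow> ('v, 'e) path \<Rightarrow> 'v set" where
  "tail_of E G act x = prange E ` grpd_orbit E G act x"

definition vertices_in :: "('v, 'e) pre_digraph \<Rightarrow> 'v set \<Rightarrow> 'e stream \<Rightarrow> bool" where
  "vertices_in E M x \<longleftrightarrow> (\<forall>n. rng E (x !! n) \<in> M)"

definition no_entry_in :: "('v, 'e) pre_digraph \<Rightarrow> 'v set \<Rightarrow> 'e stream \<Rightarrow> bool" where
  "no_entry_in E M x \<longleftrightarrow> (\<forall>n. edges_into_from E (rng E (x !! n)) M = {x !! n})"

text \<open>The infinite paths outside \<open>A\<close> with vertices in \<open>M\<close> and no entry in \<open>M\<close>.\<close>
definition loop_paths :: "('v, 'e) pre_digraph \<Rightarrow> ('g, 'b) monoid_scheme \<Rightarrow>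
    ('g \<Rightarrow> ('v, 'e) fpath \<Rightarrow> ('v, 'e) fpath) \<Rightarrow> 'v set \<Rightarrow> 'e stream set" where
  "loop_paths E G act M =
     {x \<in> infinite_paths E. InfPath x \<notin> aperiodic_paths E G act \<and>
        vertices_in E M x \<and> no_entry_in E M x}"

definition tails_L :: "('v, 'e) pre_digraph \<Rightarrow> ('g, 'b) monoid_scheme \<Rightarrow>
    ('g \<Rightarrow> ('v, 'e) fpath \<Rightarrow> ('v, 'e) fpath) \<Rightarrow> 'v set set" where
  "tails_L E G act = {M \<in> maximal_tails E G act. loop_paths E G act M \<noteq> {}}"

definition tails_gamma :: "('v, 'e) pre_digraph \<Rightarrow> ('g, 'b) monoid_scheme \<Rightarrow>
    ('g \<Rightarrow> ('v, 'e) fpath \<Rightarrow> ('v, 'e) fpath) \<Rightarrow> 'v set set" where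
  "tails_gamma E G act = maximal_tails E G act - tails_L E G act"

definition tails_0 :: "('v, 'e) pre_digraph \<Rightarrow> ('g, 'b) monoid_scheme \<Rightarrow>
    ('g \<Rightarrow> ('v, 'e) fpath \<Rightarrow> ('v, 'e) fpath) \<Rightarrow> 'v set set" where
  "tails_0 E G act =
     {M \<in> maximal_tails E G act. \<exists>v. minimal_in E M v \<and> edges_into_from E v M = {}}"

definition tails_infty :: "('v, 'e) pre_digraph \<Rightarrow> ('g, 'b) monoid_scheme \<Rightarrow>
    ('g \<Rightarrow> ('v, 'e) fpath \<Rightarrow> ('v, 'e) fpath) \<Rightarrow> 'v set set" where
  "tails_infty E G act = tails_gamma E G act - tails_0 E G act"

definition breaking_vertices :: "('v, 'e) pre_digraph \<Rightarrow> ('g, 'b) monoid_scheme \<Rightarrow>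
    ('g \<Rightarrow> ('v, 'e) fpath \<Rightarrow> ('v, 'e) fpath) \<Rightarrow> 'v set" where
  "breaking_vertices E G act =
     {v \<in> singular_vertices E.
        let B = {e \<in> arcs E. rng E e = v \<and> (\<exists>g \<in> carrier G. path_ge E (src E e) (vact act g v))}
        in finite B \<and> B \<noteq> {}}"

definition tails_and_breaking_orbits :: "('v, 'e) pre_digraph \<Rightarrow> ('g, 'b) monoid_scheme \<Rightarrow>
    ('g \<Rightarrow> ('v, 'e) fpath \<Rightarrow> ('v, 'e) fpath) \<Rightarrow> ('v set + 'v set) set" where
  "tails_and_breaking_orbits E G act =
     maximal_tails E G act <+> orbits G (breaking_vertices E G act) (vact act)"

end

theory Submission imports Defs
begin

text \<open>
  The closure of the orbit of a boundary path \<open>x\<close> can be computed explicitly.  Write \<open>M = M\<^sub>G(x)\<close>.  An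
  infinite path lies in the closure if and only if all its vertices lie in \<open>M\<close>
  (\<open>InfPath_in_closure_iff\<close>).  A finite path with singular source \<open>w\<close> lies in it if and only if \<open>wE\<^sup>1M\<close> is
  infinite or \<open>x\<close> is finite with source in the orbit \<open>G\<cdot>w\<close> (\<open>FinPath_in_closure_iff\<close>).  So the closure
  depends only on \<open>M\<close> and, for finite \<open>x\<close>, on the orbit of the source.

  When is the second datum needed?  Let \<open>x\<close> be finite with source \<open>w\<close>, so that \<open>M = M\<^sub>G(w)\<close>.  If \<open>wE\<^sup>1M\<close>
  is infinite, \<open>w\<close> lies in the closure of every orbit with tail \<open>M\<close>.  If \<open>wE\<^sup>1M\<close> is empty, every path with tail \<open>M\<close>
  ends in the orbit of \<open>w\<close>.  In the remaining case \<open>w\<close> is a breaking vertex, and then the closure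
  remembers \<open>G\<cdot>w\<close>.  Therefore quasi-orbits are classified by a label: the orbit \<open>G\<cdot>s(x)\<close> if \<open>x\<close> is finite
  and \<open>s(x)\<close> is breaking, and the tail \<open>M\<^sub>G(x)\<close> otherwise (\<open>quasi_orbit_label_eq_iff\<close>).

  It remains to see which labels occur.  Breaking orbits are the labels of their vertices.  A maximal
  tail \<open>M\<close> with a vertex \<open>v\<close> such that \<open>vE\<^sup>1M\<close> is empty is the label of \<open>v\<close> (\<open>sink_in_tail\<close>).  If \<open>M\<close> contains
  an infinite path without entry, \<open>M\<close> is the label of this path (\<open>tail_of_no_entry\<close>).  In all other cases
  a path that is generic in the sense of Baire category has tail \<open>M\<close> and is moreover aperiodic, because
  for fixed \<open>g\<close>, \<open>n\<close> and \<open>m\<close> with \<open>n \<noteq> m\<close> a solution of \<open>\<sigma>\<^sup>n(x) = g\<cdot>\<sigma>\<^sup>m(x)\<close> is determined by an initial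
  segment, whereas paths in \<open>M\<close> keep branching (\<open>aperiodic_realisation\<close>).  This is where countability is
  used.

  Finally, a function on labels satisfies the required conditions if and only if it sends the label of
  each boundary path to its quasi-orbit (\<open>characterising_clauses_iff\<close>).  Exactly one function does, and its
  inverse is the label.
\<close>

section \<open>Paths and their vertices\<close>

fun ptake :: "nat \<Rightarrow> ('v, 'e) path \<Rightarrow> 'e list" where
  "ptake n (FinPath p) = take n (snd p)"
| "ptake n (InfPath x) = stake n x"

text \<open>
  The \<open>n\<close>-th vertex of \<open>x\<close>, counted from its range.  For a finite path of length \<open>n\<close> it is the source.
\<close>
definition pvert :: "('v, 'e) pre_digraph \<Rightarrow> ('v, 'e) path \<Rightarrow> nat \<Rightarrow> 'v" where
  "pvert E x n = prange E ((shift1 E ^^ n) x)"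

lemma stake_Suc_snoc: "stake (Suc n) x = stake n x @ [x !! n]"
  by (induction n arbitrary: x) auto

lemma shift1_pow_InfPath: "(shift1 E ^^ n) (InfPath x) = InfPath (sdrop n x)"
  by (induction n arbitrary: x) (simp_all add: funpow_swap1 del: funpow.simps(2) sdrop_simps(2) add: funpow_Suc_right)

context pre_digraph
begin

lemma shift1_pow_FinPath:
  "n \<le> length es \<Longrightarrow> (shift1 G ^^ n) (FinPath (v, es)) = FinPath (awlast v (take n es), drop n es)"
proof (induction es arbitrary: v n)
  case (Cons e es)
  then show ?case
    by (cases n) (simp_all del: funpow.simps(2) add: funpow_Suc_right)
qed simp

end

lemma pvert_0 [simp]: "pvert E x 0 = prange E x"
  by (simp add: pvert_def)

lemma pvert_shift: "pvert E ((shift1 E ^^ n) x) k = pvert E x (n + k)"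
  by (simp add: pvert_def funpow_add[symmetric] add.commute flip: comp_apply[of "shift1 E ^^ k"])

lemma pvert_InfPath [simp]: "pvert E (InfPath x) n = rng E (x !! n)"
  by (simp add: pvert_def shift1_pow_InfPath)

lemma plength_FinPath [simp]: "plength (FinPath (v, es)) = enat (length es)"
  by (simp add: flength_def)

(* The general equation would leave flength of a pair behind. *)
declare plength.simps(1) [simp del]

context wf_digraph
begin

lemma finite_paths_iff: "(v, es) \<in> finite_paths G \<longleftrightarrow> awalk v es (awlast v es)"
  unfolding finite_paths_def by auto

lemma awalk_finite_path:
  "awalk v es w \<Longrightarrow> (v, es) \<in> finite_paths G \<and> fsource G (v, es) = w \<and> frange (v, es) = v"
  unfolding finite_paths_def fsource_def frange_def by auto

lemma finite_path_cases:
  assumes "p \<in> finite_paths G"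
  obtains es where "p = (frange p, es)" "awalk (frange p) es (fsource G p)"
  using assms unfolding finite_paths_def frange_def fsource_def by auto

lemma path_ge_iff: "path_ge G v w \<longleftrightarrow> (\<exists>es. awalk v es w)"
  unfolding path_ge_def by (metis awalk_finite_path finite_path_cases)

lemma path_ge_refl: "v \<in> verts G \<Longrightarrow> path_ge G v v"
  unfolding path_ge_iff by (auto simp: awalk_Nil_iff intro!: exI[of _ "[]"])

lemma path_ge_trans: "path_ge G u v \<Longrightarrow> path_ge G v w \<Longrightarrow> path_ge G u w"
  unfolding path_ge_iff by (meson awalk_appendI)

lemma path_ge_edge: "e \<in> arcs G \<Longrightarrow> path_ge G (tail G e) (head G e)"
  unfolding path_ge_iff by (meson arc_implies_awalk)

lemma path_ge_verts: "path_ge G v w \<Longrightarrow> v \<in> verts G \<and> w \<in> verts G"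
  unfolding path_ge_iff by auto

lemma infinite_path_awalk:
  assumes "x \<in> infinite_paths G"
  shows "awalk (tail G (x !! 0)) (stake n x) (tail G (x !! n))"
proof (induction n)
  case 0
  have "x !! 0 \<in> arcs G" using assms unfolding infinite_paths_def by blast
  then show ?case by (simp add: awalk_Nil_iff)
next
  case (Suc n)
  have "awalk (tail G (x !! n)) [x !! n] (tail G (x !! Suc n))"
    using assms unfolding infinite_paths_def by (metis (mono_tags, lifting) mem_Collect_eq arc_implies_awalk)
  with Suc show ?case unfolding stake_Suc_snoc by (metis awalk_appendI)
qed

lemma infinite_pathI:
  assumes "\<And>n. \<exists>w. awalk v (stake n x) w"
  shows "x \<in> infinite_paths G" and "awalk v (stake n x) (tail G (x !! n))"
proof -
  have *: "awalk v (stake n x) (tail G (x !! n))" "x !! n \<in> arcs G" for n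
  proof -
    obtain w where "awalk v (stake (Suc n) x) w" using assms by blast
    then show "awalk v (stake n x) (tail G (x !! n))" "x !! n \<in> arcs G"
      unfolding stake_Suc_snoc by (auto simp: awalk_Cons_iff)
  qed
  show "awalk v (stake n x) (tail G (x !! n))" by (rule *)
  show "x \<in> infinite_paths G" unfolding infinite_paths_def
  proof (clarsimp simp: *(2) simp del: snth.simps)
    fix n
    have "awalk v (stake n x @ [x !! n]) (tail G (x !! Suc n))" using *(1)[of "Suc n"] unfolding stake_Suc_snoc .
    then show "head G (x !! n) = tail G (x !! Suc n)" by (auto simp: awalk_Cons_iff awalk_Nil_iff)
  qed
qed

lemma InfPath_boundary_iff [simp]: "InfPath x \<in> boundary G \<longleftrightarrow> x \<in> infinite_paths G"
  unfolding boundary_def by auto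

lemma FinPath_boundary_iff:
  "FinPath (v, es) \<in> boundary G \<longleftrightarrow> (\<exists>w. awalk v es w \<and> w \<in> singular_vertices G)"
  unfolding boundary_def finite_paths_def fsource_def by auto

lemma boundary_cases:
  assumes "x \<in> boundary G"
  obtains (fin) v es w where "x = FinPath (v, es)" "awalk v es w" "w \<in> singular_vertices G"
    "awlast v es = w"
  | (inf) y where "x = InfPath y" "y \<in> infinite_paths G"
  using assms by (cases x) (auto simp: FinPath_boundary_iff)

lemma awalk_split:
  assumes "awalk v es w"
  shows "awalk v (take n es) (awlast v (take n es))" "awalk (awlast v (take n es)) (drop n es) w"
proof -
  have "awalk v (take n es @ drop n es) w" using assms by simp
  then show "awalk v (take n es) (awlast v (take n es))" "awalk (awlast v (take n es)) (drop n es) w"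
    unfolding awalk_append_iff by auto
qed

text \<open>
  Cutting a boundary path at position \<open>n\<close>, and the converse \<open>pconcat_boundary\<close>.  Everything
  about shifts and vertices of boundary paths is derived from these two lemmas, so that most later
  arguments need not distinguish finite from infinite paths.
\<close>
lemma boundary_split:
  assumes "x \<in> boundary G" and n: "enat n \<le> plength x"
  shows "awalk (prange G x) (ptake n x) (pvert G x n) \<and> (shift1 G ^^ n) x \<in> boundary G \<and>
     pconcat (prange G x, ptake n x) ((shift1 G ^^ n) x) = x \<and> length (ptake n x) = n"
  using assms(1)
proof (cases rule: boundary_cases)
  case (fin v es w)
  then show ?thesis
    using n awalk_split[OF fin(2)]
    by (auto simp: pvert_def frange_def shift1_pow_FinPath FinPath_boundary_iff fconcat_def)
next
  case (inf y)
  have "awalk (tail G (y !! n)) (stake k (sdrop n y)) (tail G (y !! (n + k)))" for k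
    using infinite_path_awalk[OF inf(2), of "n + k"] infinite_path_awalk[OF inf(2), of n]
    by (auto simp flip: stake_add)
  then have "sdrop n y \<in> infinite_paths G" by (meson infinite_pathI)
  then show ?thesis
    using inf infinite_path_awalk[OF inf(2), of n]
    by (simp add: shift1_pow_InfPath stake_sdrop)
qed

lemma pconcat_boundary:
  assumes "x \<in> boundary G" and "awalk v es (prange G x)"
  shows "pconcat (v, es) x \<in> boundary G \<and> prange G (pconcat (v, es) x) = v \<and>
     ptake (length es) (pconcat (v, es) x) = es \<and>
     (shift1 G ^^ length es) (pconcat (v, es) x) = x \<and>
     plength (pconcat (v, es) x) = length es + plength x"
  using assms(1)
proof (cases rule: boundary_cases)
  case (fin u fs w)
  then show ?thesis
    using assms(2) by (auto simp: frange_def fconcat_def FinPath_boundary_iff shift1_pow_FinPath)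
next
  case (inf y)
  have "\<exists>w. awalk v (stake n (es @- y)) w" for n
    using assms(2) inf infinite_path_awalk[OF inf(2), of "n - length es"] awalk_split(1)[of v es _ n]
    by (cases "n \<le> length es") (auto simp: stake_shift)
  then have "es @- y \<in> infinite_paths G" "awalk v (stake 0 (es @- y)) (tail G ((es @- y) !! 0))"
    by (meson infinite_pathI)+
  then show ?thesis
    using inf by (auto simp: shift1_pow_InfPath stake_shift sdrop_shift awalk_Nil_iff)
qed

lemma prange_verts: "x \<in> boundary G \<Longrightarrow> prange G x \<in> verts G"
  using boundary_split[of x 0] by (auto simp flip: zero_enat_def)

lemma pvert_verts: "x \<in> boundary G \<Longrightarrow> enat n \<le> plength x \<Longrightarrow> pvert G x n \<in> verts G"
  using boundary_split[of x n] by auto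

lemma path_ge_pvert:
  assumes "x \<in> boundary G" "enat n \<le> plength x" "k \<le> n"
  shows "path_ge G (pvert G x k) (pvert G x n)"
proof -
  define y where "y = (shift1 G ^^ k) x"
  have k: "enat k \<le> plength x" using assms(2,3) by (meson enat_ord_simps(1) order_trans)
  then have y: "y \<in> boundary G" unfolding y_def using assms boundary_split by blast
  have "plength x = length (ptake k x) + plength y"
    using pconcat_boundary[of y "prange G x" "ptake k x"] boundary_split[OF assms(1) k] y
    by (simp add: y_def pvert_def)
  then have "enat (n - k) \<le> plength y"
    using assms(2,3) boundary_split[OF assms(1) k] by (cases "plength y") auto
  from boundary_split[OF y this] show ?thesis
    unfolding path_ge_iff using assms(3) by (auto simp: y_def pvert_shift simp flip: pvert_def)
qed

end

section \<open>The action on paths\<close>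

context self_similar_graph
begin

lemma vertex_finite_path: "v \<in> verts E \<longleftrightarrow> (v, []) \<in> finite_paths E"
  by (auto simp: finite_paths_iff awalk_Nil_iff)

lemma act_finite_path:
  assumes "g \<in> carrier G" "p \<in> finite_paths E"
  shows "act g p \<in> finite_paths E"
  using group_action.element_image[OF action assms] by blast

lemma act_vertex:
  assumes "g \<in> carrier G" "v \<in> verts E"
  shows "act g (v, []) = (vact act g v, [])"
  using act_length[of g "(v, [])"] assms
  by (cases "act g (v, [])") (auto simp: vertex_finite_path flength_def vact_def frange_def)

lemma vact_verts: "g \<in> carrier G \<Longrightarrow> v \<in> verts E \<Longrightarrow> vact act g v \<in> verts E"
  using act_finite_path[of g "(v, [])"] by (auto simp: vertex_finite_path act_vertex)

lemma vact_one: "v \<in> verts E \<Longrightarrow> vact act \<one>\<^bsub>G\<^esub> v = v"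
  using group_action.id_eq_one[OF action] vertex_finite_path[of v]
  by (metis frange_def fst_conv restrict_apply vact_def)

lemma vact_mult:
  assumes "g \<in> carrier G" "h \<in> carrier G" "v \<in> verts E"
  shows "vact act (g \<otimes>\<^bsub>G\<^esub> h) v = vact act g (vact act h v)"
  using group_action.composition_rule[OF action, of "(v, [])" g h] assms
  by (simp add: act_vertex vact_verts flip: vertex_finite_path)

lemma vact_inv:
  assumes "g \<in> carrier G" "v \<in> verts E"
  shows "vact act (inv\<^bsub>G\<^esub> g) (vact act g v) = v" and "vact act g (vact act (inv\<^bsub>G\<^esub> g) v) = v"
  using assms vact_mult[of "inv\<^bsub>G\<^esub> g" g v] vact_mult[of g "inv\<^bsub>G\<^esub> g" v] vact_one by auto

text \<open>
  Range and source of \<open>g\<cdot>\<mu>\<close> are known to be the translates of those of \<open>\<mu>\<close>, so what remains of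
  the action on finite paths is its effect on words of edges.
\<close>
definition edges_act :: "'g \<Rightarrow> 'v \<Rightarrow> 'e list \<Rightarrow> 'e list" where
  "edges_act g v es = snd (act g (v, es))"

lemma act_awalk:
  assumes "g \<in> carrier G" "awalk v es w"
  shows "act g (v, es) = (vact act g v, edges_act g v es)"
    and "awalk (vact act g v) (edges_act g v es) (vact act g w)"
    and "length (edges_act g v es) = length es"
proof -
  have p: "(v, es) \<in> finite_paths E" "fsource E (v, es) = w" "frange (v, es) = v"
    using awalk_finite_path[OF assms(2)] by auto
  have vw: "v \<in> verts E" "w \<in> verts E" using assms(2) by auto
  have "frange (act g (v, es)) = vact act g v"
    using act_range[OF assms(1) p(1)] act_vertex[OF assms(1)] vw p by auto
  then show *: "act g (v, es) = (vact act g v, edges_act g v es)"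
    by (cases "act g (v, es)") (auto simp: edges_act_def frange_def)
  have "fsource E (act g (v, es)) = vact act g w"
    using act_source[OF assms(1) p(1)] act_vertex[OF assms(1)] vw p by auto
  then show "awalk (vact act g v) (edges_act g v es) (vact act g w)"
    using act_finite_path[OF assms(1) p(1)] unfolding * by (auto simp: finite_paths_iff fsource_def)
  show "length (edges_act g v es) = length es"
    using act_length[OF assms(1) p(1)] unfolding edges_act_def by (simp add: flength_def)
qed

lemma path_ge_vact: "g \<in> carrier G \<Longrightarrow> path_ge E v w \<Longrightarrow> path_ge E (vact act g v) (vact act g w)"
  unfolding path_ge_iff by (meson act_awalk)

lemma edges_act_append:
  assumes "g \<in> carrier G" "awalk v es u" "awalk u fs w"
  shows "edges_act g v (es @ fs) = edges_act g v es @ edges_act (restr g (v, es)) u fs"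
proof -
  have "act g (fconcat (v, es) (u, fs)) = fconcat (act g (v, es)) (act (restr g (v, es)) (u, fs))"
    by (rule act_concat) (use assms awalk_finite_path in auto)
  then show ?thesis by (simp add: fconcat_def edges_act_def)
qed

text \<open>
  The action respects initial segments because \<open>g\<cdot>(\<mu>\<nu>) = (g\<cdot>\<mu>)(g|\<^sub>\<mu>\<cdot>\<nu>)\<close>.  This is what makes it
  extend to infinite paths.
\<close>
lemma edges_act_take:
  assumes "g \<in> carrier G" "awalk v es w"
  shows "edges_act g v (take n es) = take n (edges_act g v es)"
proof -
  have "edges_act g v (take n es @ drop n es) =
      edges_act g v (take n es) @ edges_act (restr g (v, take n es)) (awlast v (take n es)) (drop n es)"
    using assms awalk_split by (intro edges_act_append)
  moreover have "length (edges_act g v (take n es)) = min (length es) n"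
    using act_awalk(3)[OF assms(1) awalk_split(1)[OF assms(2)]] by simp
  moreover have "length (edges_act g v es) = length es" using act_awalk(3) assms by blast
  ultimately show ?thesis by (cases "n \<le> length es") (auto simp: min_def)
qed

lemma edges_act_inj:
  assumes "g \<in> carrier G" "awalk v es w" "awalk v es' w'" "edges_act g v es = edges_act g v es'"
  shows "es = es'"
proof -
  have "act g (v, es) = act g (v, es')" using act_awalk(1) assms by metis
  then have "(v, es) = (v, es')"
    using group_action.inj_prop[OF action assms(1)] assms(2,3)[THEN awalk_finite_path] by (meson inj_onD)
  then show ?thesis by simp
qed

text \<open>
  The \<open>n\<close>-th edge of \<open>g\<cdot>x\<close> is read off from \<open>g\<cdot>(x\<^sub>1\<dots>x\<^sub>n)\<close>; by compatibility with initial segments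
  the edges obtained for different \<open>n\<close> fit together.
\<close>
lemma pact_InfPath:
  assumes "g \<in> carrier G" "x \<in> infinite_paths E"
  obtains y where "pact E act g (InfPath x) = InfPath y" "y \<in> infinite_paths E"
    "\<And>n. stake n y = edges_act g (tail E (x !! 0)) (stake n x)"
    "\<And>n. tail E (y !! n) = vact act g (tail E (x !! n))"
proof -
  define r where "r = tail E (x !! 0)"
  define y where "y = smap (\<lambda>n. last (edges_act g r (stake (Suc n) x))) nats"
  have y: "pact E act g (InfPath x) = InfPath y" by (simp add: y_def r_def edges_act_def)
  have w: "awalk r (stake n x) (tail E (x !! n))" for n
    using infinite_path_awalk[OF assms(2)] r_def by blast
  have st: "stake n y = edges_act g r (stake n x)" for n
  proof (induction n)
    case 0
    then show ?case using act_awalk(3)[OF assms(1) w[of 0]] by simp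
  next
    case (Suc n)
    let ?es = "edges_act g r (stake (Suc n) x)"
    have l: "length ?es = Suc n" using act_awalk(3)[OF assms(1) w] by (metis length_stake)
    have "edges_act g r (take n (stake (Suc n) x)) = take n ?es" by (rule edges_act_take[OF assms(1) w])
    then have "edges_act g r (stake n x) = butlast ?es" using l by (simp add: butlast_conv_take take_stake del: stake.simps)
    moreover have "y !! n = last ?es" by (simp add: y_def del: stake.simps)
    ultimately show ?case unfolding stake_Suc_snoc[of n y] Suc using l
      by (metis append_butlast_last_id length_0_conv nat.simps(3))
  qed
  have aw: "awalk (vact act g r) (stake n y) (vact act g (tail E (x !! n)))" for n
    unfolding st by (rule act_awalk[OF assms(1) w])
  then have yi: "y \<in> infinite_paths E" and yw: "awalk (vact act g r) (stake n y) (tail E (y !! n))" for n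
    by (meson infinite_pathI)+
  have "tail E (y !! n) = vact act g (tail E (x !! n))" for n
    using awlast_of_awalk[OF aw[of n]] awlast_of_awalk[OF yw[of n]] by simp
  then show thesis using that[OF y yi] st unfolding r_def by blast
qed

definition edge_act :: "'g \<Rightarrow> 'e \<Rightarrow> 'e" where
  "edge_act g e = hd (edges_act g (tail E e) [e])"

lemma edge_act_arc:
  assumes "g \<in> carrier G" "e \<in> arcs E"
  shows "edges_act g (tail E e) [e] = [edge_act g e]" and "edge_act g e \<in> arcs E"
    and "tail E (edge_act g e) = vact act g (tail E e)"
    and "head E (edge_act g e) = vact act g (head E e)"
proof -
  have w: "awalk (tail E e) [e] (head E e)" by (rule arc_implies_awalk[OF assms(2)])
  show *: "edges_act g (tail E e) [e] = [edge_act g e]"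
    using act_awalk(3)[OF assms(1) w] by (auto simp: edge_act_def length_Suc_conv)
  have "awalk (vact act g (tail E e)) [edge_act g e] (vact act g (head E e))"
    using act_awalk(2)[OF assms(1) w] unfolding * .
  then show "edge_act g e \<in> arcs E" "tail E (edge_act g e) = vact act g (tail E e)"
    "head E (edge_act g e) = vact act g (head E e)"
    by (auto simp: awalk_Cons_iff awalk_Nil_iff)
qed

lemma edge_act_edges_into:
  assumes "g \<in> carrier G" "\<And>v. v \<in> M \<Longrightarrow> vact act g v \<in> M"
  shows "inj_on (edge_act g) (edges_into_from E v M)"
    and "edge_act g ` edges_into_from E v M \<subseteq> edges_into_from E (vact act g v) M"
proof -
  show "inj_on (edge_act g) (edges_into_from E v M)"
  proof (rule inj_onI)
    fix e f
    assume *: "e \<in> edges_into_from E v M" "f \<in> edges_into_from E v M" "edge_act g e = edge_act g f"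
    then have a: "e \<in> arcs E" "f \<in> arcs E" "tail E e = v" "tail E f = v"
      by (auto simp: edges_into_from_def)
    then have "edges_act g v [e] = edges_act g v [f]" using edge_act_arc(1)[OF assms(1)] *(3) by metis
    then have "[e] = [f]" using edges_act_inj[OF assms(1)] a by (metis arc_implies_awalk)
    then show "e = f" by simp
  qed
  show "edge_act g ` edges_into_from E v M \<subseteq> edges_into_from E (vact act g v) M"
    using edge_act_arc[OF assms(1)] assms(2) by (auto simp: edges_into_from_def)
qed

definition invariant :: "'v set \<Rightarrow> bool" where
  "invariant M \<longleftrightarrow> M \<subseteq> verts E \<and> (\<forall>g \<in> carrier G. \<forall>v \<in> M. vact act g v \<in> M)"

text \<open>
  Acting by \<open>g\<close> embeds \<open>vE\<^sup>1M\<close> into \<open>(g\<cdot>v)E\<^sup>1M\<close>, and acting by the inverse embeds it back.  Hence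
  whether this set is empty, finite or infinite depends only on the orbit of \<open>v\<close>; in particular
  singular and breaking vertices are permuted by the group.
\<close>
lemma edges_into_vact:
  assumes "invariant M" "g \<in> carrier G" "v \<in> verts E"
  shows "edges_into_from E (vact act g v) M = {} \<longleftrightarrow> edges_into_from E v M = {}"
    and "finite (edges_into_from E (vact act g v) M) \<longleftrightarrow> finite (edges_into_from E v M)"
proof -
  have *: "(edges_into_from E (vact act h u) M = {} \<longrightarrow> edges_into_from E u M = {}) \<and>
     (finite (edges_into_from E (vact act h u) M) \<longrightarrow> finite (edges_into_from E u M))"
    if "h \<in> carrier G" for h u
  proof -
    have "\<And>v. v \<in> M \<Longrightarrow> vact act h v \<in> M" using assms(1) that by (simp add: invariant_def)
    note e = edge_act_edges_into[OF that this]
    show ?thesis using e(2)[of u] finite_imageD[OF _ e(1)[of u]] by (auto dest: finite_subset)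
  qed
  show "edges_into_from E (vact act g v) M = {} \<longleftrightarrow> edges_into_from E v M = {}"
    "finite (edges_into_from E (vact act g v) M) \<longleftrightarrow> finite (edges_into_from E v M)"
    using *[of g v] *[of "inv\<^bsub>G\<^esub> g" "vact act g v"] vact_inv(1) assms(2,3) by auto
qed

lemma singular_iff:
  "v \<in> singular_vertices E \<longleftrightarrow> v \<in> verts E \<and>
     (edges_into_from E v (verts E) = {} \<or> infinite (edges_into_from E v (verts E)))"
proof -
  have "edges_into_from E v (verts E) = {e \<in> arcs E. tail E e = v}"
    by (auto simp: edges_into_from_def)
  then show ?thesis by (auto simp: singular_vertices_def)
qed

lemma singular_vact:
  assumes "g \<in> carrier G" "v \<in> singular_vertices E"
  shows "vact act g v \<in> singular_vertices E"
proof -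
  have "invariant (verts E)" by (auto simp: invariant_def vact_verts)
  then show ?thesis using assms edges_into_vact vact_verts unfolding singular_iff by metis
qed

lemma pact_boundary:
  assumes "g \<in> carrier G" "x \<in> boundary E"
  shows "pact E act g x \<in> boundary E \<and> plength (pact E act g x) = plength x \<and>
    (\<forall>n. enat n \<le> plength x \<longrightarrow> pvert E (pact E act g x) n = vact act g (pvert E x n))"
  using assms(2)
proof (cases rule: boundary_cases)
  case (fin v es w)
  note a = act_awalk[OF assms(1) fin(2)]
  have "awlast (vact act g v) (take n (edges_act g v es)) = vact act g (awlast v (take n es))" for n
    using act_awalk(2)[OF assms(1) awalk_split(1)[OF fin(2)], of n] edges_act_take[OF assms(1) fin(2)]
    by auto
  then show ?thesis
    using a singular_vact[OF assms(1) fin(3)]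
    by (auto simp: fin(1) pvert_def shift1_pow_FinPath FinPath_boundary_iff frange_def)
next
  case (inf y)
  then show ?thesis using pact_InfPath[OF assms(1) inf(2)] by (metis InfPath_boundary_iff plength.simps(2) pvert_InfPath)
qed

lemma prange_pact: "g \<in> carrier G \<Longrightarrow> x \<in> boundary E \<Longrightarrow> prange E (pact E act g x) = vact act g (prange E x)"
  using pact_boundary[of g x] by (metis pvert_0 zero_enat_def zero_le)

end

section \<open>The topology of the boundary path space\<close>

lemma closure_of_meets_nbhd:
  assumes "y \<in> X closure_of S" "openin X U" "y \<in> U"
  obtains z where "z \<in> S" "z \<in> U"
  using assms unfolding in_closure_of by blast

context wf_digraph
begin

lemma plength_shift:
  assumes "x \<in> boundary G" "enat n \<le> plength x"
  shows "plength x = enat n + plength ((shift1 G ^^ n) x)"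
  using boundary_split[OF assms] pconcat_boundary[of "(shift1 G ^^ n) x" "prange G x" "ptake n x"]
  by (simp flip: pvert_def)

lemma take_ptake: "k \<le> n \<Longrightarrow> take k (ptake n z) = ptake k z"
  by (cases z) (auto simp: take_stake min_def)

lemma length_ptake_le: "length (ptake n z) = n \<longleftrightarrow> enat n \<le> plength z"
  by (cases z) (auto simp: flength_def plength.simps(1))

lemma cylinder_iff:
  assumes "awalk v es w"
  shows "z \<in> cylinder G (v, es) \<longleftrightarrow> z \<in> boundary G \<and> prange G z = v \<and> ptake (length es) z = es"
proof
  assume "z \<in> cylinder G (v, es)"
  then show "z \<in> boundary G \<and> prange G z = v \<and> ptake (length es) z = es"
    using assms pconcat_boundary awalk_finite_path[OF assms] unfolding cylinder_def by auto
next
  assume z: "z \<in> boundary G \<and> prange G z = v \<and> ptake (length es) z = es"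
  then have "enat (length es) \<le> plength z" by (metis length_ptake_le)
  with z boundary_split[of z "length es"]
  have *: "awalk v es (pvert G z (length es))" "(shift1 G ^^ length es) z \<in> boundary G"
    "pconcat (v, es) ((shift1 G ^^ length es) z) = z"
    by auto
  moreover have "prange G ((shift1 G ^^ length es) z) = fsource G (v, es)"
    using awalk_finite_path[OF *(1)] by (simp add: pvert_def)
  ultimately show "z \<in> cylinder G (v, es)" unfolding cylinder_def by (metis (mono_tags, lifting) mem_Collect_eq)
qed

lemma cylinder_prefix_cong:
  assumes "(v, es) \<in> finite_paths G" "length es \<le> n" "y \<in> boundary G" "z \<in> boundary G"
    and "prange G y = prange G z" "ptake n y = ptake n z"
  shows "y \<in> cylinder G (v, es) \<longleftrightarrow> z \<in> cylinder G (v, es)"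
proof -
  have "ptake (length es) y = ptake (length es) z" using assms(2,6) by (metis take_ptake)
  then show ?thesis using assms by (auto simp: cylinder_iff[OF finite_paths_iff[THEN iffD1, OF assms(1)]])
qed

lemma fconcat_finite_paths:
  assumes "a \<in> finite_paths G" "b \<in> finite_paths G" "frange b = fsource G a"
  shows "fconcat a b \<in> finite_paths G"
proof -
  obtain es fs where "a = (frange a, es)" "awalk (frange a) es (fsource G a)"
    "b = (frange b, fs)" "awalk (frange b) fs (fsource G b)"
    using assms finite_path_cases by metis
  then show ?thesis using assms(3) awalk_appendI awalk_finite_path
    by (metis fconcat_def fst_conv snd_conv)
qed

lemma cylinder_subset: "a \<in> finite_paths G \<Longrightarrow> cylinder G a \<subseteq> boundary G"
  by (metis cylinder_iff finite_path_cases subsetI)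

abbreviation basic_sets :: "('a, 'b) path set set" where
  "basic_sets \<equiv> {cylinder G a - (\<Union>b\<in>F. cylinder G (fconcat a b)) | a F.
        a \<in> finite_paths G \<and> finite F \<and> F \<subseteq> {b \<in> finite_paths G. frange b = fsource G a}}"

lemma openin_boundary: "openin (boundary_topology G) U \<longleftrightarrow> generate_topology_on basic_sets U"
  unfolding boundary_topology_def by (rule openin_topology_generated_by_iff)

lemma topspace_boundary: "topspace (boundary_topology G) = boundary G"
proof -
  have "z \<in> \<Union> basic_sets" if "z \<in> boundary G" for z
  proof -
    have "awalk (prange G z) [] (prange G z)" using prange_verts[OF that] by (simp add: awalk_Nil_iff)
    then have "z \<in> cylinder G (prange G z, []) - (\<Union>b\<in>{}. cylinder G (fconcat (prange G z, []) b))"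
      "(prange G z, []) \<in> finite_paths G"
      using that awalk_finite_path by (auto simp: cylinder_iff ptake.simps) (cases z; simp)
    then show ?thesis by blast
  qed
  moreover have "s \<subseteq> boundary G" if "s \<in> basic_sets" for s
    using that cylinder_subset by blast
  ultimately have "\<Union> basic_sets = boundary G" by (meson Sup_least subsetI subset_antisym)
  then show ?thesis unfolding boundary_topology_def topology_generated_by_topspace .
qed

text \<open>
  A basic set excludes only finitely many cylinders.  An initial segment of an infinite path that is
  longer than all words involved decides membership in each of them, so the cylinders of the initial
  segments form a neighbourhood base.
\<close>
lemma cylinder_nbhd_of_InfPath:
  assumes "openin (boundary_topology G) U" "InfPath y \<in> U"
  obtains n where "cylinder G (tail G (y !! 0), stake n y) \<subseteq> U"
proof -
  let ?r = "tail G (y !! 0)"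
  have y: "InfPath y \<in> boundary G" using assms openin_subset topspace_boundary by fastforce
  then have aw: "awalk ?r (stake n y) (tail G (y !! n))" for n using infinite_path_awalk by simp
  have mono: "cylinder G (?r, stake n y) \<subseteq> cylinder G (?r, stake m y)" if "m \<le> n" for m n
  proof
    fix z assume "z \<in> cylinder G (?r, stake n y)"
    then show "z \<in> cylinder G (?r, stake m y)"
      unfolding cylinder_iff[OF aw] length_stake
      using that take_ptake[OF that, of z] take_stake[of m n y] by (simp add: min_def)
  qed
  have "generate_topology_on basic_sets U" using assms(1) openin_boundary by blast
  then have "InfPath y \<in> U \<longrightarrow> (\<exists>n. cylinder G (?r, stake n y) \<subseteq> U)"
  proof induction
    case (Int a b)
    show ?case
    proof
      assume "InfPath y \<in> a \<inter> b"
      then obtain k m where "cylinder G (?r, stake k y) \<subseteq> a" "cylinder G (?r, stake m y) \<subseteq> b"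
        using Int by blast
      then have "cylinder G (?r, stake (max k m) y) \<subseteq> a \<inter> b"
        using mono[of k "max k m"] mono[of m "max k m"] by (meson Int_greatest max.cobounded1 max.cobounded2 order_trans)
      then show "\<exists>n. cylinder G (?r, stake n y) \<subseteq> a \<inter> b" by blast
    qed
  next
    case (UN K)
    then show ?case by blast
  next
    case (Basis s)
    then obtain a F where s: "s = cylinder G a - (\<Union>b\<in>F. cylinder G (fconcat a b))"
      "a \<in> finite_paths G" "finite F" "F \<subseteq> {b \<in> finite_paths G. frange b = fsource G a}" by blast
    \<comment> \<open>An upper bound for the lengths of all words that define the basic set.\<close>
    define n where "n = length (snd a) + (\<Sum>b\<in>F. length (snd b))"
    have n: "length (snd (fconcat a b)) \<le> n" if "b \<in> F" for b
      using member_le_sum[OF that, of "\<lambda>b. length (snd b)"] s(3) by (simp add: n_def fconcat_def)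
    have "z \<in> s" if "InfPath y \<in> s" "z \<in> cylinder G (?r, stake n y)" for z
    proof -
      have z: "z \<in> boundary G" "prange G z = ?r" "ptake n z = stake n y"
        using that(2) unfolding cylinder_iff[OF aw] by auto
      have "z \<in> cylinder G c \<longleftrightarrow> InfPath y \<in> cylinder G c"
        if "c \<in> finite_paths G" "length (snd c) \<le> n" for c
        using cylinder_prefix_cong[of "fst c" "snd c" n z "InfPath y"] z y that by simp
      moreover have "fconcat a b \<in> finite_paths G" if "b \<in> F" for b
        using fconcat_finite_paths s that by blast
      moreover have "length (snd a) \<le> n" by (simp add: n_def)
      ultimately show ?thesis using that(1) n s(2) unfolding s(1) by blast
    qed
    then show ?case by blast
  qed simp
  then show ?thesis using that assms(2) by blast
qed

text \<open>
  An excluded cylinder does not contain the finite path itself, so where it meets the cylinder of the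
  path it prolongs the path by at least one edge.  Excluding that edge excludes the whole cylinder, so
  the sets obtained by forbidding finitely many next edges form a neighbourhood base.
\<close>
lemma basic_nbhd_of_FinPath:
  assumes "openin (boundary_topology G) U" "FinPath (v, es) \<in> U"
  obtains F where "finite F"
    "{z \<in> boundary G. prange G z = v \<and> ptake (length es) z = es \<and>
        (\<forall>e\<in>F. ptake (Suc (length es)) z \<noteq> es @ [e])} \<subseteq> U"
proof -
  let ?N = "\<lambda>F. {z \<in> boundary G. prange G z = v \<and> ptake (length es) z = es \<and>
        (\<forall>e\<in>F. ptake (Suc (length es)) z \<noteq> es @ [e])}"
  have y: "FinPath (v, es) \<in> boundary G" using assms openin_subset topspace_boundary by fastforce
  have "generate_topology_on basic_sets U" using assms(1) openin_boundary by blast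
  then have "FinPath (v, es) \<in> U \<longrightarrow> (\<exists>F. finite F \<and> ?N F \<subseteq> U)"
  proof induction
    case (Int a b)
    show ?case
    proof
      assume "FinPath (v, es) \<in> a \<inter> b"
      then obtain F F' where "finite F" "finite F'" "?N F \<subseteq> a" "?N F' \<subseteq> b" using Int by blast
      then have "finite (F \<union> F')" "?N (F \<union> F') \<subseteq> a \<inter> b" by blast+
      then show "\<exists>F. finite F \<and> ?N F \<subseteq> a \<inter> b" by blast
    qed
  next
    case (UN K)
    then show ?case by (meson Union_iff Union_upper order_trans)
  next
    case (Basis s)
    then obtain a F where s: "s = cylinder G a - (\<Union>b\<in>F. cylinder G (fconcat a b))"
      "a \<in> finite_paths G" "finite F" "F \<subseteq> {b \<in> finite_paths G. frange b = fsource G a}" by blast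
    \<comment> \<open>For the shorter excluded words the chosen letter has no meaning; forbidding it does no harm.\<close>
    let ?F' = "(\<lambda>b. snd (fconcat a b) ! length es) ` F"
    have "z \<in> s" if ys: "FinPath (v, es) \<in> s" and zN: "z \<in> ?N ?F'" for z
    proof -
      have z: "z \<in> boundary G" "prange G z = v" "ptake (length es) z = es" using zN by auto
      have le: "length (snd a) \<le> length es"
      proof -
        have "FinPath (v, es) \<in> cylinder G (fst a, snd a)" using ys s(1) by simp
        then have "take (length (snd a)) es = snd a"
          using cylinder_iff[of "fst a" "snd a" _ "FinPath (v, es)"] s(2) finite_paths_iff[of "fst a" "snd a"]
          by auto
        then show ?thesis by (metis length_take min_def nat_le_linear)
      qed
      have iff: "z \<in> cylinder G c \<longleftrightarrow> FinPath (v, es) \<in> cylinder G c"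
        if "c \<in> finite_paths G" "length (snd c) \<le> length es" for c
        using cylinder_prefix_cong[of "fst c" "snd c" "length es" z "FinPath (v, es)"] z y that
        by (simp add: frange_def)
      have "z \<notin> cylinder G (fconcat a b)" if b: "b \<in> F" for b
      proof
        assume zc: "z \<in> cylinder G (fconcat a b)"
        define cs where "cs = snd (fconcat a b)"
        have fc: "fconcat a b = (fst a, cs)" by (simp add: fconcat_def cs_def)
        have fp: "fconcat a b \<in> finite_paths G" using fconcat_finite_paths s b by blast
        have "FinPath (v, es) \<notin> cylinder G (fconcat a b)" using ys s(1) b by blast
        with iff[OF fp] zc have l: "length es < length cs" by (force simp: cs_def)
        have "ptake (length cs) z = cs"
          using zc cylinder_iff[of "fst a" cs _ z] fp finite_paths_iff unfolding fc by blast
        then have "ptake (Suc (length es)) z = take (Suc (length es)) cs" "ptake (length es) z = take (length es) cs"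
          using l take_ptake[of "Suc (length es)" "length cs" z] take_ptake[of "length es" "length cs" z] by auto
        then have "ptake (Suc (length es)) z = es @ [cs ! length es]"
          using l z(3) by (simp add: take_Suc_conv_app_nth)
        then show False using zN b by (auto simp: cs_def)
      qed
      then show ?thesis using iff[OF s(2) le] ys unfolding s(1) by blast
    qed
    then show ?case using s(3) by (meson finite_imageI subsetI)
  qed simp
  then show ?thesis using that assms(2) by blast
qed

lemma openin_cylinder_minus_edges:
  assumes "awalk v es w" "finite F" "F \<subseteq> arcs G" "\<And>e. e \<in> F \<Longrightarrow> tail G e = w"
  shows "openin (boundary_topology G) {z \<in> boundary G. prange G z = v \<and> ptake (length es) z = es \<and>
        (\<forall>e\<in>F. ptake (Suc (length es)) z \<noteq> es @ [e])}"
proof -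
  let ?B = "(\<lambda>e. (w, [e])) ` F"
  have "awalk w [e] (head G e)" if "e \<in> F" for e using assms that by (metis arc_implies_awalk subsetD)
  then have e: "(w, [e]) \<in> finite_paths G" "awalk v (es @ [e]) (head G e)" if "e \<in> F" for e
    using that assms(1) awalk_finite_path awalk_appendI by blast+
  have "{z \<in> boundary G. prange G z = v \<and> ptake (length es) z = es \<and>
        (\<forall>e\<in>F. ptake (Suc (length es)) z \<noteq> es @ [e])} =
      cylinder G (v, es) - (\<Union>b\<in>?B. cylinder G (fconcat (v, es) b))"
    using cylinder_iff[OF assms(1)] cylinder_iff[OF e(2)] by (auto simp: fconcat_def)
  moreover have "(v, es) \<in> finite_paths G \<and> finite ?B \<and> ?B \<subseteq> {b \<in> finite_paths G. frange b = fsource G (v, es)}"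
    using awalk_finite_path[OF assms(1)] assms(2) e(1) by (auto simp: frange_def)
  ultimately show ?thesis
    unfolding openin_boundary by (intro generate_topology_on.Basis) blast
qed

end

section \<open>Orbits and their closures\<close>

context self_similar_graph
begin

lemma orbitI:
  assumes "enat n \<le> plength x" "g \<in> carrier G" "z = pact E act g ((shift1 E ^^ n) x)"
    and "awalk v es (prange E z)"
  shows "pconcat (v, es) z \<in> grpd_orbit E G act x"
  unfolding grpd_orbit_def
proof (intro CollectI exI conjI)
  show "pconcat (v, es) z = pconcat (v, es) (pact E act g ((shift1 E ^^ n) x))" by (simp add: assms(3))
  show "fsource E (v, es) = prange E (pact E act g ((shift1 E ^^ n) x))" "(v, es) \<in> finite_paths E"
    using awalk_finite_path[OF assms(4)] assms(3) by auto
qed (use assms in auto)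

lemma orbit_cases:
  assumes "x \<in> boundary E" "y \<in> grpd_orbit E G act x"
  obtains u es z g n where "y = pconcat (u, es) z" "z = pact E act g ((shift1 E ^^ n) x)"
    "enat n \<le> plength x" "g \<in> carrier G" "awalk u es (prange E z)" "z \<in> boundary E"
    "prange E z = vact act g (pvert E x n)"
proof -
  from assms(2) obtain m g n where m: "y = pconcat m (pact E act g ((shift1 E ^^ n) x))"
      "enat n \<le> plength x" "g \<in> carrier G" "m \<in> finite_paths E"
      "fsource E m = prange E (pact E act g ((shift1 E ^^ n) x))"
    unfolding grpd_orbit_def by blast
  obtain u es where "m = (u, es)" "awalk u es (fsource E m)" using m(4) by (metis finite_path_cases)
  then show ?thesis
    using that m boundary_split[OF assms(1) m(2)] pact_boundary[OF m(3)] prange_pact[OF m(3)]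
    by (metis pvert_def)
qed

lemma tail_of_iff:
  assumes "x \<in> boundary E"
  shows "v \<in> tail_of E G act x \<longleftrightarrow>
    (\<exists>g \<in> carrier G. \<exists>n. enat n \<le> plength x \<and> path_ge E v (vact act g (pvert E x n)))"
proof -
  have z: "pact E act g ((shift1 E ^^ n) x) \<in> boundary E"
    "prange E (pact E act g ((shift1 E ^^ n) x)) = vact act g (pvert E x n)"
    if "g \<in> carrier G" "enat n \<le> plength x" for g n
    using boundary_split[OF assms that(2)] pact_boundary[OF that(1)] prange_pact[OF that(1)]
    by (auto simp: pvert_def)
  show ?thesis
  proof
    assume "v \<in> tail_of E G act x"
    then obtain y where "y \<in> grpd_orbit E G act x" "v = prange E y" unfolding tail_of_def by blast
    then obtain u es z g n where y: "y = pconcat (u, es) z" "enat n \<le> plength x" "g \<in> carrier G"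
      "awalk u es (prange E z)" "z \<in> boundary E" "prange E z = vact act g (pvert E x n)" "v = prange E y"
      using orbit_cases[OF assms] by metis
    then have "awalk v es (vact act g (pvert E x n))" using pconcat_boundary[OF y(5,4)] by simp
    then have "path_ge E v (vact act g (pvert E x n))" unfolding path_ge_iff by (rule exI)
    then show "\<exists>g \<in> carrier G. \<exists>n. enat n \<le> plength x \<and> path_ge E v (vact act g (pvert E x n))"
      using y(2,3) by (intro bexI exI conjI)
  next
    assume "\<exists>g \<in> carrier G. \<exists>n. enat n \<le> plength x \<and> path_ge E v (vact act g (pvert E x n))"
    then obtain g n es where m: "g \<in> carrier G" "enat n \<le> plength x" "awalk v es (vact act g (pvert E x n))"
      unfolding path_ge_iff by blast
    define y where "y = pconcat (v, es) (pact E act g ((shift1 E ^^ n) x))"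
    have "y \<in> grpd_orbit E G act x"
      unfolding y_def by (rule orbitI[OF m(2,1) refl]) (simp add: m z(2))
    moreover have "prange E y = v"
      using pconcat_boundary[OF z(1)[OF m(1,2)], of v es] z(2)[OF m(1,2)] m(3) unfolding y_def by metis
    ultimately show "v \<in> tail_of E G act x" unfolding tail_of_def by blast
  qed
qed

lemma orbit_boundary: "x \<in> boundary E \<Longrightarrow> grpd_orbit E G act x \<subseteq> boundary E"
  by (metis orbit_cases pconcat_boundary subsetI)

text \<open>
  A path in the orbit of \<open>x\<close> consists of a finite piece that ends at a translate of a vertex of \<open>x\<close>,
  followed by translates of vertices of \<open>x\<close>.  So all its vertices, and not only its range, lie in
  \<open>M\<^sub>G(x)\<close>.
\<close>
lemma orbit_pvert_in_tail:
  assumes x: "x \<in> boundary E" and y: "y \<in> grpd_orbit E G act x" and k: "enat k \<le> plength y"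
  shows "pvert E y k \<in> tail_of E G act x"
proof -
  from x y obtain u es z g n where z: "y = pconcat (u, es) z" "z = pact E act g ((shift1 E ^^ n) x)"
    "enat n \<le> plength x" "g \<in> carrier G" "awalk u es (prange E z)" "z \<in> boundary E"
    "prange E z = vact act g (pvert E x n)"
    by (rule orbit_cases)
  have yc: "y \<in> boundary E" "(shift1 E ^^ length es) y = z" "plength y = length es + plength z"
    using pconcat_boundary[OF z(6,5)] z(1) by auto
  show ?thesis
  proof (cases "k \<le> length es")
    case True
    have "enat (length es) \<le> plength y" using yc(3) by (metis le_iff_add)
    then have "path_ge E (pvert E y k) (pvert E y (length es))"
      using path_ge_pvert[OF yc(1) _ True] by blast
    also have "pvert E y (length es) = vact act g (pvert E x n)" using yc(2) z(7) by (simp add: pvert_def)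
    finally show ?thesis using tail_of_iff[OF x] z by blast
  next
    case False
    then obtain j where j: "k = length es + j" using nat_le_iff_add nat_le_linear by blast
    note s = boundary_split[OF x z(3)]
    have "enat j \<le> plength z" using k yc(3) j by (cases "plength z") auto
    then have j': "enat j \<le> plength ((shift1 E ^^ n) x)" using pact_boundary[OF z(4)] s z(2) by metis
    have "pvert E y k = pvert E z j" using yc(2) j pvert_shift by metis
    also have "\<dots> = vact act g (pvert E ((shift1 E ^^ n) x) j)"
      using pact_boundary[OF z(4)] s z(2) j' by metis
    also have "\<dots> = vact act g (pvert E x (n + j))" by (simp add: pvert_shift)
    finally have eq: "pvert E y k = vact act g (pvert E x (n + j))" .
    have nj: "enat (n + j) \<le> plength x"
      using plength_shift[OF x z(3)] j' by (cases "plength ((shift1 E ^^ n) x)") auto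
    then have "vact act g (pvert E x (n + j)) \<in> verts E" using pvert_verts[OF x] vact_verts z(4) by blast
    then show ?thesis unfolding eq tail_of_iff[OF x] using path_ge_refl z(4) nj by blast
  qed
qed

lemma orbit_pconcat:
  assumes x: "x \<in> boundary E" and y: "y \<in> grpd_orbit E G act x" and "awalk v es (prange E y)"
  shows "pconcat (v, es) y \<in> grpd_orbit E G act x"
proof -
  from x y obtain u fs z g n where z: "y = pconcat (u, fs) z" "z = pact E act g ((shift1 E ^^ n) x)"
    "enat n \<le> plength x" "g \<in> carrier G" "awalk u fs (prange E z)" "z \<in> boundary E"
    "prange E z = vact act g (pvert E x n)"
    by (rule orbit_cases)
  have "prange E y = u" using pconcat_boundary[OF z(6,5)] z(1) by simp
  then have "awalk v (es @ fs) (prange E z)" using assms(3) z(5) by auto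
  moreover have "pconcat (v, es) y = pconcat (v, es @ fs) z"
    unfolding z(1) by (cases z) (auto simp: fconcat_def)
  ultimately show ?thesis using orbitI[OF z(3,4,2)] by simp
qed

text \<open>
  What has to be known about a boundary path, besides its tail, to describe the closure of its orbit.
  The set is empty exactly for the infinite paths.
\<close>
definition end_orbit :: "('v, 'e) path \<Rightarrow> 'v set" where
  "end_orbit x = {vact act g (fsource E p) | g p. g \<in> carrier G \<and> x = FinPath p}"

lemma FinPath_in_orbit_iff:
  assumes x: "x \<in> boundary E" and y: "awalk v es w"
  shows "FinPath (v, es) \<in> grpd_orbit E G act x \<longleftrightarrow> w \<in> end_orbit x"
proof
  assume "FinPath (v, es) \<in> grpd_orbit E G act x"
  then obtain u fs z g n where z: "FinPath (v, es) = pconcat (u, fs) z" "z = pact E act g ((shift1 E ^^ n) x)"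
    "enat n \<le> plength x" "g \<in> carrier G" "awalk u fs (prange E z)"
    by (rule orbit_cases[OF x])
  obtain p where p: "x = FinPath p"
    using x z(1,2) by (cases x) (auto simp: shift1_pow_InfPath)
  obtain a as b where a: "p = (a, as)" "awalk a as b" using x p by (cases p) (auto simp: FinPath_boundary_iff)
  have "z = FinPath (act g (awlast a (take n as), drop n as))"
    using z(3) by (simp add: z(2) p a(1) shift1_pow_FinPath)
  then have zf: "z = FinPath (vact act g (awlast a (take n as)), edges_act g (awlast a (take n as)) (drop n as))"
    and zw: "awalk (vact act g (awlast a (take n as))) (edges_act g (awlast a (take n as)) (drop n as)) (vact act g b)"
    using act_awalk[OF z(4) awalk_split(2)[OF a(2), of n]] by auto
  have "awalk v es (vact act g b)"
    using z(1,5) zw awalk_appendI unfolding zf by (auto simp: fconcat_def frange_def)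
  then have "w = vact act g b" using y by auto
  moreover have "b = fsource E p" using a awalk_finite_path by metis
  ultimately show "w \<in> end_orbit x" unfolding end_orbit_def using z(4) p by blast
next
  assume "w \<in> end_orbit x"
  then obtain g p where gp: "g \<in> carrier G" "x = FinPath p" "w = vact act g (fsource E p)"
    unfolding end_orbit_def by blast
  obtain a as b where a: "p = (a, as)" "awalk a as b" using x gp(2) by (cases p) (auto simp: FinPath_boundary_iff)
  have b: "b = fsource E p" "b \<in> verts E" using a awalk_finite_path by fastforce+
  have "pact E act g ((shift1 E ^^ length as) x) = FinPath (w, [])"
    using b a act_vertex[OF gp(1) b(2)] gp by (simp add: shift1_pow_FinPath)
  moreover have "pconcat (v, es) (FinPath (w, [])) = FinPath (v, es)" by (simp add: fconcat_def)
  moreover have "enat (length as) \<le> plength x" using gp(2) a by simp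
  ultimately show "FinPath (v, es) \<in> grpd_orbit E G act x"
    using orbitI[of "length as" x g "FinPath (w, [])" v es] gp(1) y by (simp add: frange_def)
qed

text \<open>
  The cylinder of an initial segment \<open>\<alpha>\<close> meets the orbit of \<open>x\<close> if and only if some path of the orbit has
  range \<open>s(\<alpha>)\<close>, because \<open>\<alpha>\<close> can be put in front of such a path.
\<close>
lemma InfPath_in_closure_iff:
  assumes x: "x \<in> boundary E" and y: "y \<in> infinite_paths E"
  shows "InfPath y \<in> boundary_topology E closure_of grpd_orbit E G act x \<longleftrightarrow>
    (\<forall>n. tail E (y !! n) \<in> tail_of E G act x)"
proof
  assume cl: "InfPath y \<in> boundary_topology E closure_of grpd_orbit E G act x"
  show "\<forall>n. tail E (y !! n) \<in> tail_of E G act x"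
  proof
    fix n
    note aw = infinite_path_awalk[OF y, of n]
    obtain z where z: "z \<in> grpd_orbit E G act x" "prange E z = tail E (y !! 0)" "ptake n z = stake n y"
      using closure_of_meets_nbhd[OF cl openin_cylinder_minus_edges[OF aw, of "{}"]] y by auto
    then have l: "enat n \<le> plength z" by (metis length_ptake_le length_stake)
    have "awalk (tail E (y !! 0)) (stake n y) (pvert E z n)"
      using boundary_split[OF _ l] orbit_boundary[OF x] z by (metis subsetD)
    then have "pvert E z n = tail E (y !! n)" using aw by auto
    then show "tail E (y !! n) \<in> tail_of E G act x" using orbit_pvert_in_tail[OF x z(1) l] by simp
  qed
next
  assume R: "\<forall>n. tail E (y !! n) \<in> tail_of E G act x"
  have "\<exists>z. z \<in> grpd_orbit E G act x \<and> z \<in> U" if U: "InfPath y \<in> U" "openin (boundary_topology E) U" for U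
  proof -
    obtain n where n: "cylinder E (tail E (y !! 0), stake n y) \<subseteq> U"
      using cylinder_nbhd_of_InfPath U by blast
    note aw = infinite_path_awalk[OF y, of n]
    obtain z where z: "z \<in> grpd_orbit E G act x" "prange E z = tail E (y !! n)"
      using R unfolding tail_of_def by (metis imageE)
    have "pconcat (tail E (y !! 0), stake n y) z \<in> cylinder E (tail E (y !! 0), stake n y)"
      using z orbit_boundary[OF x] awalk_finite_path[OF aw] unfolding cylinder_def by auto
    then show ?thesis using orbit_pconcat[OF x z(1)] aw z(2) n by (metis subsetD)
  qed
  then show "InfPath y \<in> boundary_topology E closure_of grpd_orbit E G act x"
    using y unfolding in_closure_of topspace_boundary by auto
qed

text \<open>
  A path of the orbit close to the finite path \<open>\<alpha>\<close> either equals \<open>\<alpha>\<close>, which forces \<open>x\<close> to end in the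
  orbit of \<open>s(\<alpha>)\<close>, or prolongs \<open>\<alpha>\<close> by an edge with source in \<open>M\<^sub>G(x)\<close>.  Since finitely many next edges may
  be forbidden, the second kind accumulates at \<open>\<alpha>\<close> exactly if there are infinitely many such edges.
\<close>
lemma FinPath_in_closure_iff:
  assumes x: "x \<in> boundary E" and y: "awalk v es w" "w \<in> singular_vertices E"
  shows "FinPath (v, es) \<in> boundary_topology E closure_of grpd_orbit E G act x \<longleftrightarrow>
    w \<in> end_orbit x \<or> infinite (edges_into_from E w (tail_of E G act x))"
proof
  assume cl: "FinPath (v, es) \<in> boundary_topology E closure_of grpd_orbit E G act x"
  let ?F = "edges_into_from E w (tail_of E G act x)"
  show "w \<in> end_orbit x \<or> infinite ?F"
  proof (rule ccontr)
    assume "\<not> (w \<in> end_orbit x \<or> infinite ?F)"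
    then have n: "w \<notin> end_orbit x" "finite ?F" by auto
    let ?N = "{z \<in> boundary E. prange E z = v \<and> ptake (length es) z = es \<and>
        (\<forall>e\<in>?F. ptake (Suc (length es)) z \<noteq> es @ [e])}"
    have "openin (boundary_topology E) ?N"
      by (rule openin_cylinder_minus_edges[OF y(1) n(2)]) (auto simp: edges_into_from_def)
    moreover have "FinPath (v, es) \<in> ?N" using y by (auto simp: FinPath_boundary_iff frange_def)
    ultimately obtain z where z: "z \<in> grpd_orbit E G act x" "z \<in> ?N"
      by (rule closure_of_meets_nbhd[OF cl])
    have "z \<noteq> FinPath (v, es)" using FinPath_in_orbit_iff[OF x y(1)] z(1) n(1) by blast
    then have l: "enat (Suc (length es)) \<le> plength z"
      using z(2) by (cases z) (auto simp: frange_def plength.simps(1) flength_def not_less_eq_eq)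
    have zb: "z \<in> boundary E" using z(2) by simp
    note s = boundary_split[OF zb l]
    have "take (length es) (ptake (Suc (length es)) z) = es" using z(2) take_ptake[of "length es" "Suc (length es)" z] by simp
    then obtain e where e: "ptake (Suc (length es)) z = es @ [e]"
      using s take_Suc_conv_app_nth[of "length es" "ptake (Suc (length es)) z"] by simp
    have "awalk v (es @ [e]) (pvert E z (Suc (length es)))" using s e z(2) by simp
    then have "e \<in> arcs E" "tail E e = w" "head E e = pvert E z (Suc (length es))"
      using y(1) by (auto simp: awalk_Cons_iff awalk_Nil_iff)
    then have "e \<in> ?F" using orbit_pvert_in_tail[OF x z(1) l] by (simp add: edges_into_from_def)
    then show False using z(2) e by blast
  qed
next
  assume R: "w \<in> end_orbit x \<or> infinite (edges_into_from E w (tail_of E G act x))"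
  have "\<exists>z. z \<in> grpd_orbit E G act x \<and> z \<in> U" if U: "FinPath (v, es) \<in> U" "openin (boundary_topology E) U" for U
    using R
  proof
    assume "w \<in> end_orbit x"
    then show ?thesis using FinPath_in_orbit_iff[OF x y(1)] U(1) by blast
  next
    assume inf: "infinite (edges_into_from E w (tail_of E G act x))"
    obtain F where F: "finite F" "{z \<in> boundary E. prange E z = v \<and> ptake (length es) z = es \<and>
        (\<forall>e\<in>F. ptake (Suc (length es)) z \<noteq> es @ [e])} \<subseteq> U"
      by (rule basic_nbhd_of_FinPath[OF U(2,1)])
    obtain e where "e \<in> edges_into_from E w (tail_of E G act x) - F"
      using inf F(1) by (metis Diff_infinite_finite ex_in_conv finite.emptyI)
    then have e: "e \<in> arcs E" "tail E e = w" "head E e \<in> tail_of E G act x" "e \<notin> F"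
      by (auto simp: edges_into_from_def)
    then obtain z where z: "z \<in> grpd_orbit E G act x" "prange E z = head E e"
      unfolding tail_of_def by (metis imageE)
    have aw: "awalk v (es @ [e]) (prange E z)"
      using awalk_appendI[OF y(1)] arc_implies_awalk[OF e(1)] e(2) z(2) by simp
    have zb: "z \<in> boundary E" using z orbit_boundary[OF x] by blast
    let ?z = "pconcat (v, es @ [e]) z"
    have "?z \<in> grpd_orbit E G act x" by (rule orbit_pconcat[OF x z(1) aw])
    moreover have zz: "?z \<in> boundary E" "prange E ?z = v" "ptake (Suc (length es)) ?z = es @ [e]"
      using pconcat_boundary[OF zb aw] by auto
    moreover have "ptake (length es) ?z = es"
      using take_ptake[of "length es" "Suc (length es)" ?z] zz(3) by simp
    ultimately have "?z \<in> U" using e(4) by (intro subsetD[OF F(2)]) auto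
    then show ?thesis using \<open>?z \<in> grpd_orbit E G act x\<close> by blast
  qed
  then show "FinPath (v, es) \<in> boundary_topology E closure_of grpd_orbit E G act x"
    using y unfolding in_closure_of topspace_boundary by (auto simp: FinPath_boundary_iff)
qed

lemma closure_orbit_subset: "boundary_topology E closure_of grpd_orbit E G act x \<subseteq> boundary E"
  using closure_of_subset_topspace topspace_boundary by metis

end

section \<open>Maximal tails\<close>

context self_similar_graph
begin

lemma maximal_tailD:
  assumes "M \<in> maximal_tails E G act"
  shows "M \<noteq> {}" "invariant M" "\<And>v w. path_ge E v w \<Longrightarrow> w \<in> M \<Longrightarrow> v \<in> M"
    "\<And>v. v \<in> M \<Longrightarrow> edges_into_from E v M = {} \<Longrightarrow> v \<in> singular_vertices E"
    "\<And>v w. v \<in> M \<Longrightarrow> w \<in> M \<Longrightarrow> \<exists>g \<in> carrier G. \<exists>u \<in> M. path_ge E v u \<and> path_ge E w (vact act g u)"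
  using assms unfolding maximal_tails_def invariant_def by blast+

lemma invariant_tail_of:
  assumes "x \<in> boundary E"
  shows "invariant (tail_of E G act x)"
  unfolding invariant_def
proof (intro conjI ballI)
  show "tail_of E G act x \<subseteq> verts E" using orbit_boundary[OF assms] prange_verts unfolding tail_of_def by auto
  fix g v assume g: "g \<in> carrier G" and "v \<in> tail_of E G act x"
  then obtain h n where h: "h \<in> carrier G" "enat n \<le> plength x" "path_ge E v (vact act h (pvert E x n))"
    using tail_of_iff[OF assms] by blast
  have "path_ge E (vact act g v) (vact act (g \<otimes>\<^bsub>G\<^esub> h) (pvert E x n))"
    using path_ge_vact[OF g h(3)] vact_mult[OF g h(1) pvert_verts[OF assms h(2)]] by simp
  then show "vact act g v \<in> tail_of E G act x" using tail_of_iff[OF assms] h(1,2) g by blast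
qed

lemma tail_of_hereditary:
  "x \<in> boundary E \<Longrightarrow> path_ge E v w \<Longrightarrow> w \<in> tail_of E G act x \<Longrightarrow> v \<in> tail_of E G act x"
  unfolding tail_of_iff by (meson path_ge_trans)

lemma pvert_in_tail_of:
  assumes "x \<in> boundary E" "enat n \<le> plength x"
  shows "pvert E x n \<in> tail_of E G act x"
  using tail_of_iff[OF assms(1)] vact_one path_ge_refl pvert_verts assms by (metis one_closed)

lemma tail_of_least:
  assumes "x \<in> boundary E" "\<And>n. enat n \<le> plength x \<Longrightarrow> pvert E x n \<in> M"
    and "invariant M" "\<And>v w. path_ge E v w \<Longrightarrow> w \<in> M \<Longrightarrow> v \<in> M"
  shows "tail_of E G act x \<subseteq> M"
  using assms(2-4) unfolding tail_of_iff[OF assms(1)] invariant_def subset_iff by meson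

lemma end_orbit_singular:
  assumes "x \<in> boundary E" "v \<in> end_orbit x"
  shows "v \<in> singular_vertices E"
  using assms singular_vact unfolding end_orbit_def boundary_def by blast

text \<open>
  Take a path of the orbit with range \<open>v\<close>: either it has a first edge, or it is the vertex \<open>v\<close>.
\<close>
lemma edge_or_end:
  assumes "x \<in> boundary E" "v \<in> tail_of E G act x"
  shows "edges_into_from E v (tail_of E G act x) \<noteq> {} \<or> v \<in> end_orbit x"
proof -
  obtain z where z: "z \<in> grpd_orbit E G act x" "prange E z = v" using assms(2) unfolding tail_of_def by blast
  have zb: "z \<in> boundary E" using orbit_boundary assms(1) z by blast
  show ?thesis
  proof (cases "enat 1 \<le> plength z")
    case True
    note s = boundary_split[OF zb True]
    then obtain e where "ptake 1 z = [e]" by (metis One_nat_def length_0_conv length_Suc_conv)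
    then have "e \<in> arcs E" "tail E e = v" "head E e = pvert E z 1" using s z(2) by (auto simp: awalk_Cons_iff awalk_Nil_iff)
    then have "e \<in> edges_into_from E v (tail_of E G act x)"
      using orbit_pvert_in_tail[OF assms(1) z(1) True] by (simp add: edges_into_from_def)
    then show ?thesis by blast
  next
    case False
    from zb show ?thesis
    proof (cases rule: boundary_cases)
      case (fin u es w)
      then have "es = []" using False by (cases es) (auto simp: one_enat_def)
      then have "FinPath (v, []) \<in> grpd_orbit E G act x" using z fin by (simp add: frange_def)
      moreover have "awalk v [] v" using prange_verts[OF zb] z(2) by (simp add: awalk_Nil_iff)
      ultimately show ?thesis using FinPath_in_orbit_iff[OF assms(1)] by blast
    next
      case (inf y)
      then show ?thesis using False by simp
    qed
  qed
qed

text \<open>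
  Two translates of the sequence of vertices of \<open>x\<close> can be compared at a common later position, which
  gives directedness.  A vertex without an edge into it from the tail is the end of a path in the
  orbit and therefore singular.
\<close>
theorem tail_of_maximal:
  assumes "x \<in> boundary E"
  shows "tail_of E G act x \<in> maximal_tails E G act"
proof -
  let ?M = "tail_of E G act x"
  have ne: "?M \<noteq> {}" using pvert_in_tail_of[OF assms, of 0] by (auto simp flip: zero_enat_def)
  have dir: "\<exists>g \<in> carrier G. \<exists>u \<in> ?M. path_ge E v u \<and> path_ge E w (vact act g u)"
    if v: "v \<in> ?M" and w: "w \<in> ?M" for v w
  proof -
    obtain g n where g: "g \<in> carrier G" "enat n \<le> plength x" "path_ge E v (vact act g (pvert E x n))"
      using v tail_of_iff[OF assms] by blast
    obtain h m where h: "h \<in> carrier G" "enat m \<le> plength x" "path_ge E w (vact act h (pvert E x m))"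
      using w tail_of_iff[OF assms] by blast
    let ?k = "max n m"
    have k: "enat ?k \<le> plength x" using g h by (simp add: max_def)
    let ?u = "vact act g (pvert E x ?k)"
    have p: "pvert E x ?k \<in> verts E" using pvert_verts[OF assms k] .
    have "path_ge E v ?u" using path_ge_trans[OF g(3) path_ge_vact[OF g(1) path_ge_pvert[OF assms k]]] by simp
    moreover have "path_ge E w (vact act h (pvert E x ?k))"
      using path_ge_trans[OF h(3) path_ge_vact[OF h(1) path_ge_pvert[OF assms k]]] by simp
    then have "path_ge E w (vact act (h \<otimes>\<^bsub>G\<^esub> inv\<^bsub>G\<^esub> g) ?u)"
      using vact_mult[OF h(1), of "inv\<^bsub>G\<^esub> g" ?u] vact_inv(1)[OF g(1) p] g(1) vact_verts[OF g(1) p] by simp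
    moreover have "?u \<in> ?M"
      using tail_of_iff[OF assms] g(1) k path_ge_refl vact_verts[OF g(1) p] by blast
    moreover have "h \<otimes>\<^bsub>G\<^esub> inv\<^bsub>G\<^esub> g \<in> carrier G" using g(1) h(1) by simp
    ultimately show ?thesis by (intro bexI[of _ "h \<otimes>\<^bsub>G\<^esub> inv\<^bsub>G\<^esub> g"] bexI[of _ ?u] conjI)
  qed
  have "edges_into_from E v ?M \<noteq> {}" if "v \<in> ?M" "v \<notin> singular_vertices E" for v
    using edge_or_end[OF assms that(1)] end_orbit_singular[OF assms] that(2) by blast
  then show ?thesis
    unfolding maximal_tails_def
  proof (intro CollectI conjI ballI allI impI)
    show "?M \<subseteq> verts E" "\<And>g v. g \<in> carrier G \<Longrightarrow> v \<in> ?M \<Longrightarrow> vact act g v \<in> ?M"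
      using invariant_tail_of[OF assms] unfolding invariant_def by auto
    show "\<And>v w. path_ge E v w \<Longrightarrow> w \<in> ?M \<Longrightarrow> v \<in> ?M" by (rule tail_of_hereditary[OF assms])
    show "\<And>v w. v \<in> ?M \<Longrightarrow> w \<in> ?M \<Longrightarrow>
        \<exists>g \<in> carrier G. \<exists>u \<in> ?M. path_ge E v u \<and> path_ge E w (vact act g u)"
      by (rule dir)
  qed (rule ne)
qed

lemma vertex_boundary: "v \<in> singular_vertices E \<Longrightarrow> FinPath (vertex v) \<in> boundary E"
  by (auto simp: FinPath_boundary_iff awalk_Nil_iff singular_vertices_def)

lemma fsource_vertex: "fsource E (vertex v) = v"
  by (simp add: fsource_def)

lemma end_orbit_FinPath: "end_orbit (FinPath p) = orbit G (vact act) (fsource E p)"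
  unfolding end_orbit_def orbit_def by blast

lemma end_orbit_InfPath: "end_orbit (InfPath y) = {}"
  unfolding end_orbit_def by auto

lemma fsource_verts: "FinPath p \<in> boundary E \<Longrightarrow> fsource E p \<in> verts E"
  unfolding boundary_def singular_vertices_def by auto

lemma fsource_in_end_orbit: "FinPath p \<in> boundary E \<Longrightarrow> fsource E p \<in> end_orbit (FinPath p)"
  unfolding end_orbit_def
  by (intro CollectI exI[of _ "\<one>\<^bsub>G\<^esub>"] exI[of _ p]) (simp add: vact_one fsource_verts)

lemma end_orbit_translates:
  assumes "x \<in> boundary E" "v \<in> end_orbit x" "w \<in> end_orbit x"
  obtains g where "g \<in> carrier G" "w = vact act g v"
proof -
  obtain g h p where *: "g \<in> carrier G" "h \<in> carrier G" "x = FinPath p"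
    "v = vact act g (fsource E p)" "w = vact act h (fsource E p)"
    using assms(2,3) unfolding end_orbit_def by blast
  have p: "fsource E p \<in> verts E" using fsource_verts assms(1) *(3) by blast
  have "vact act (h \<otimes>\<^bsub>G\<^esub> inv\<^bsub>G\<^esub> g) v = w"
    using vact_mult[OF *(2), of "inv\<^bsub>G\<^esub> g" v] vact_inv(1)[OF *(1) p] vact_verts[OF *(1) p] *(1,4,5) by simp
  then show ?thesis using that *(1,2) by (metis inv_closed m_closed)
qed

lemma vact_end_orbit:
  assumes "x \<in> boundary E" "v \<in> end_orbit x" "g \<in> carrier G"
  shows "vact act g v \<in> end_orbit x"
proof -
  obtain h p where *: "h \<in> carrier G" "x = FinPath p" "v = vact act h (fsource E p)"
    using assms(2) unfolding end_orbit_def by blast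
  then have "vact act g v = vact act (g \<otimes>\<^bsub>G\<^esub> h) (fsource E p)"
    using vact_mult[OF assms(3) *(1)] fsource_verts assms(1) by simp
  then show ?thesis unfolding end_orbit_def using * assms(3) by blast
qed

lemma end_orbit_eqI:
  assumes "x \<in> boundary E" "y \<in> boundary E" "v \<in> end_orbit x" "v \<in> end_orbit y"
  shows "end_orbit x = end_orbit y"
proof -
  have "end_orbit a \<subseteq> end_orbit b"
    if a: "a \<in> boundary E" "v \<in> end_orbit a" and b: "b \<in> boundary E" "v \<in> end_orbit b" for a b
  proof
    fix w assume "w \<in> end_orbit a"
    then obtain g where "g \<in> carrier G" "w = vact act g v" by (rule end_orbit_translates[OF a])
    then show "w \<in> end_orbit b" using vact_end_orbit[OF b] by simp
  qed
  then show ?thesis using assms by (meson subset_antisym)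
qed

text \<open>
  Every vertex of a finite path dominates its source, so the translates of the source alone
  determine the tail.
\<close>
lemma tail_of_end_orbit:
  assumes "x \<in> boundary E" "w \<in> end_orbit x"
  shows "v \<in> tail_of E G act x \<longleftrightarrow> (\<exists>g \<in> carrier G. path_ge E v (vact act g w))"
proof -
  obtain h p where h: "h \<in> carrier G" "x = FinPath p" "w = vact act h (fsource E p)"
    using assms(2) unfolding end_orbit_def by blast
  obtain a as b where a: "p = (a, as)" "awalk a as b" using assms(1) h(2) by (cases p) (auto simp: FinPath_boundary_iff)
  have l: "enat (length as) \<le> plength x" using h(2) a by simp
  have s: "pvert E x (length as) = fsource E p"
    using h(2) a by (simp add: pvert_def shift1_pow_FinPath frange_def fsource_def)
  have *: "path_ge E (pvert E x n) (fsource E p)" if "enat n \<le> plength x" for n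
    using path_ge_pvert[OF assms(1) l, of n] that h(2) a s by simp
  show ?thesis
  proof
    assume "v \<in> tail_of E G act x"
    then obtain g n where g: "g \<in> carrier G" "enat n \<le> plength x" "path_ge E v (vact act g (pvert E x n))"
      using tail_of_iff[OF assms(1)] by blast
    then have "path_ge E v (vact act g (fsource E p))" using * path_ge_vact path_ge_trans by blast
    moreover have "vact act g (fsource E p) \<in> end_orbit x" using g(1) h(2) unfolding end_orbit_def by blast
    ultimately show "\<exists>g \<in> carrier G. path_ge E v (vact act g w)"
      using end_orbit_translates[OF assms] by metis
  next
    assume "\<exists>g \<in> carrier G. path_ge E v (vact act g w)"
    then obtain g where g: "g \<in> carrier G" "path_ge E v (vact act g w)" by blast
    then have "vact act g w \<in> end_orbit x" using vact_end_orbit[OF assms] by blast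
    then obtain k where "k \<in> carrier G" "vact act g w = vact act k (fsource E p)"
      using h(2) unfolding end_orbit_def by blast
    then show "v \<in> tail_of E G act x" using g(2) l s tail_of_iff[OF assms(1)] by metis
  qed
qed

lemma end_orbit_subset_tail_of: "x \<in> boundary E \<Longrightarrow> end_orbit x \<subseteq> tail_of E G act x"
  using tail_of_end_orbit vact_one path_ge_refl end_orbit_singular
  by (metis one_closed path_ge_verts singular_iff subsetI)

text \<open>
  The edge set in the definition of a breaking vertex \<open>w\<close> is \<open>wE\<^sup>1M\<^sub>G(w)\<close>.
\<close>
lemma breaking_iff:
  assumes "x \<in> boundary E" "w \<in> end_orbit x"
  shows "w \<in> breaking_vertices E G act \<longleftrightarrow>
    finite (edges_into_from E w (tail_of E G act x)) \<and> edges_into_from E w (tail_of E G act x) \<noteq> {}"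
proof -
  have eq: "{e \<in> arcs E. rng E e = w \<and> (\<exists>g \<in> carrier G. path_ge E (src E e) (vact act g w))} =
    edges_into_from E w (tail_of E G act x)"
    unfolding edges_into_from_def tail_of_end_orbit[OF assms] by blast
  show ?thesis using end_orbit_singular[OF assms]
    by (simp only: breaking_vertices_def Let_def mem_Collect_eq eq simp_thms)
qed

lemma breaking_end_orbit:
  assumes "x \<in> boundary E" "v \<in> end_orbit x" "w \<in> end_orbit x" "v \<in> breaking_vertices E G act"
  shows "w \<in> breaking_vertices E G act"
proof -
  obtain g where g: "g \<in> carrier G" "w = vact act g v" using end_orbit_translates[OF assms(1-3)] .
  have "v \<in> verts E" using end_orbit_singular[OF assms(1,2)] singular_iff by blast
  then show ?thesis
    using edges_into_vact[OF invariant_tail_of[OF assms(1)] g(1), of v] assms g(2) breaking_iff by metis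
qed

section \<open>Classification of quasi-orbits\<close>

abbreviation orbit_closure :: "('v, 'e) path \<Rightarrow> ('v, 'e) path set" where
  "orbit_closure x \<equiv> boundary_topology E closure_of grpd_orbit E G act x"

lemma self_in_orbit_closure:
  assumes "x \<in> boundary E"
  shows "x \<in> orbit_closure x"
proof -
  have "pvert E x n \<in> tail_of E G act x" if "enat n \<le> plength x" for n
    using pvert_in_tail_of assms that by blast
  with assms show ?thesis
  proof (cases rule: boundary_cases)
    case (fin v es w)
    have "w = fsource E (v, es)" using fin by (simp add: fsource_def)
    then show ?thesis using fin assms fsource_in_end_orbit FinPath_in_closure_iff by metis
  next
    case (inf y)
    then show ?thesis using InfPath_in_closure_iff[OF assms] pvert_in_tail_of[OF assms] by simp
  qed
qed

text \<open>
  A finite path in the closure of the orbit of \<open>y\<close> has its source in the tail of \<open>y\<close>: the source ends a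
  path of the orbit, or infinitely many, hence at least one, of the edges with that range have source in
  the tail.
\<close>
lemma tail_of_mono:
  assumes x: "x \<in> boundary E" and y: "y \<in> boundary E" and "x \<in> orbit_closure y"
  shows "tail_of E G act x \<subseteq> tail_of E G act y"
proof (rule tail_of_least[OF x _ invariant_tail_of[OF y] tail_of_hereditary[OF y]])
  fix n assume n: "enat n \<le> plength x"
  from x show "pvert E x n \<in> tail_of E G act y"
  proof (cases rule: boundary_cases)
    case (fin v es w)
    have "w \<in> tail_of E G act y"
    proof (cases "w \<in> end_orbit y")
      case True
      then show ?thesis using end_orbit_subset_tail_of[OF y] by blast
    next
      case False
      then have "edges_into_from E w (tail_of E G act y) \<noteq> {}"
        using FinPath_in_closure_iff[OF y fin(2,3)] assms(3) fin(1) by auto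
      then obtain e where "e \<in> arcs E" "tail E e = w" "head E e \<in> tail_of E G act y"
        unfolding edges_into_from_def by blast
      then show ?thesis using tail_of_hereditary[OF y] path_ge_edge by blast
    qed
    moreover have "pvert E x (length es) = w" using fin by (simp add: pvert_def shift1_pow_FinPath frange_def)
    then have "path_ge E (pvert E x n) w" using path_ge_pvert[OF x, of "length es" n] n fin(1) by simp
    ultimately show ?thesis using tail_of_hereditary[OF y] by blast
  next
    case (inf u)
    then show ?thesis using InfPath_in_closure_iff[OF y] assms(3) by simp
  qed
qed

lemma orbit_closure_mono:
  assumes x: "x \<in> boundary E" and y: "y \<in> boundary E" and M: "tail_of E G act x \<subseteq> tail_of E G act y"
    and "\<And>w. w \<in> end_orbit x \<Longrightarrow> w \<in> end_orbit y \<or> infinite (edges_into_from E w (tail_of E G act y))"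
  shows "orbit_closure x \<subseteq> orbit_closure y"
proof
  fix z assume z: "z \<in> orbit_closure x"
  then have "z \<in> boundary E" using closure_orbit_subset by blast
  then show "z \<in> orbit_closure y"
  proof (cases rule: boundary_cases)
    case (fin v es w)
    have "edges_into_from E w (tail_of E G act x) \<subseteq> edges_into_from E w (tail_of E G act y)"
      using M unfolding edges_into_from_def by blast
    then show ?thesis
      using z assms(4) FinPath_in_closure_iff[OF _ fin(2,3)] x y finite_subset unfolding fin(1) by metis
  next
    case (inf u)
    then show ?thesis using z M InfPath_in_closure_iff x y by blast
  qed
qed

definition ends_breaking :: "('v, 'e) path \<Rightarrow> bool" where
  "ends_breaking x \<longleftrightarrow> (\<exists>p. x = FinPath p \<and> fsource E p \<in> breaking_vertices E G act)"

text \<open>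
  This is the inverse of the bijection to be constructed, read as a function on boundary paths.
\<close>
definition quasi_orbit_label :: "('v, 'e) path \<Rightarrow> 'v set + 'v set" where
  "quasi_orbit_label x = (if ends_breaking x then Inr (end_orbit x) else Inl (tail_of E G act x))"

lemma ends_breaking_iff:
  assumes "x \<in> boundary E"
  shows "ends_breaking x \<longleftrightarrow> end_orbit x \<inter> breaking_vertices E G act \<noteq> {}"
proof (cases x)
  case (FinPath p)
  then show ?thesis
    using assms fsource_in_end_orbit[of p] breaking_end_orbit[OF assms] unfolding ends_breaking_def by auto
next
  case (InfPath y)
  then show ?thesis by (simp add: ends_breaking_def end_orbit_InfPath)
qed

text \<open>
  If the source \<open>w\<close> of \<open>x\<close> is breaking, then only finitely many edges with range \<open>w\<close> have source in the
  common tail, so \<open>x\<close> can lie in the closure of the orbit of \<open>y\<close> only by lying in the orbit itself.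
\<close>
lemma end_orbit_eq_of_breaking:
  assumes x: "x \<in> boundary E" and y: "y \<in> boundary E"
    and eq: "orbit_closure x = orbit_closure y" and "ends_breaking x"
  shows "end_orbit x = end_orbit y"
proof -
  have T: "tail_of E G act x = tail_of E G act y"
    using tail_of_mono[OF x y] tail_of_mono[OF y x] self_in_orbit_closure x y eq by blast
  obtain p where p: "x = FinPath p" "fsource E p \<in> breaking_vertices E G act"
    using assms(4) unfolding ends_breaking_def by blast
  obtain v es w where w: "p = (v, es)" "awalk v es w" "w \<in> singular_vertices E"
    using x p(1) by (cases p) (auto simp: FinPath_boundary_iff)
  have ws: "w = fsource E p" using w awalk_finite_path by metis
  have "w \<in> end_orbit x" using ws fsource_in_end_orbit x p(1) by blast
  moreover from this have "finite (edges_into_from E w (tail_of E G act y))"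
    using breaking_iff[OF x] p(2) ws T by metis
  then have "w \<in> end_orbit y"
    using FinPath_in_closure_iff[OF y w(2,3)] self_in_orbit_closure[OF x] eq p(1) w(1) by blast
  ultimately show ?thesis using end_orbit_eqI[OF x y] by blast
qed

text \<open>
  If the source \<open>w\<close> of \<open>x\<close> is not breaking, the tail \<open>M\<close> either has infinitely many edges into \<open>w\<close>, and
  then \<open>w\<close> is a limit of every orbit with tail \<open>M\<close>, or it has none, and then every path with tail \<open>M\<close>
  ends in the orbit of \<open>w\<close>.
\<close>
lemma orbit_closure_subset_of_tail_eq:
  assumes x: "x \<in> boundary E" and y: "y \<in> boundary E"
    and T: "tail_of E G act x = tail_of E G act y" and "\<not> ends_breaking x"
  shows "orbit_closure x \<subseteq> orbit_closure y"
proof (rule orbit_closure_mono[OF x y])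
  fix w assume w: "w \<in> end_orbit x"
  then have "w \<notin> breaking_vertices E G act" using ends_breaking_iff[OF x] assms(4) by blast
  then show "w \<in> end_orbit y \<or> infinite (edges_into_from E w (tail_of E G act y))"
    using breaking_iff[OF x w] edge_or_end[OF y, of w] subsetD[OF end_orbit_subset_tail_of[OF x] w]
    unfolding T by auto
qed (use T in simp)

text \<open>
  Tail and end orbit determine the closure of an orbit.  The end orbit can be recovered from the
  closure only when its vertices are breaking, and it is redundant otherwise.
\<close>
theorem quasi_orbit_label_eq_iff:
  assumes x: "x \<in> boundary E" and y: "y \<in> boundary E"
  shows "quasi_orbit_label x = quasi_orbit_label y \<longleftrightarrow> orbit_closure x = orbit_closure y"
proof
  assume eq: "orbit_closure x = orbit_closure y"
  then have T: "tail_of E G act x = tail_of E G act y"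
    using tail_of_mono[OF x y] tail_of_mono[OF y x] self_in_orbit_closure x y by blast
  have "ends_breaking x \<or> ends_breaking y \<Longrightarrow> end_orbit x = end_orbit y"
    using end_orbit_eq_of_breaking x y eq by metis
  then show "quasi_orbit_label x = quasi_orbit_label y"
    using T ends_breaking_iff x y unfolding quasi_orbit_label_def by auto
next
  assume eq: "quasi_orbit_label x = quasi_orbit_label y"
  show "orbit_closure x = orbit_closure y"
  proof (cases "ends_breaking x")
    case True
    then have e: "end_orbit x = end_orbit y"
      using eq unfolding quasi_orbit_label_def by (auto split: if_splits)
    moreover obtain w where w: "w \<in> end_orbit x" using True ends_breaking_iff[OF x] by blast
    have "tail_of E G act x = tail_of E G act y"
      using tail_of_end_orbit[OF x w] tail_of_end_orbit[OF y, of w] w e by blast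
    ultimately show ?thesis
      using orbit_closure_mono[OF x y] orbit_closure_mono[OF y x] by blast
  next
    case False
    then have "\<not> ends_breaking y" "tail_of E G act x = tail_of E G act y"
      using eq unfolding quasi_orbit_label_def by (auto split: if_splits)
    then show ?thesis using False orbit_closure_subset_of_tail_eq x y by (metis subset_antisym)
  qed
qed

section \<open>Paths realising a maximal tail\<close>

text \<open>
  No vertex of \<open>M\<close> lies strictly below \<open>v\<close>, so directedness makes every vertex of \<open>M\<close> dominate a translate
  of \<open>v\<close>, whence \<open>M\<^sub>G(v) = M\<close>.  As \<open>vE\<^sup>1M\<close> is empty, \<open>v\<close> is not breaking.
\<close>
lemma sink_in_tail:
  assumes M: "M \<in> maximal_tails E G act" and v: "v \<in> M" "edges_into_from E v M = {}"
  shows "v \<in> singular_vertices E" and "quasi_orbit_label (FinPath (vertex v)) = Inl M"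
    and "minimal_in E M v"
proof -
  note m = maximal_tailD[OF M]
  show s: "v \<in> singular_vertices E" using m(4) v by blast
  have b: "FinPath (vertex v) \<in> boundary E" using s by (rule vertex_boundary)
  have e: "v \<in> end_orbit (FinPath (vertex v))" using fsource_in_end_orbit[OF b] fsource_vertex by metis
  have stop: "u = v" if "path_ge E v u" "u \<in> M" for u
  proof -
    obtain es where es: "awalk v es u" using \<open>path_ge E v u\<close> path_ge_iff by blast
    show ?thesis
    proof (cases es)
      case (Cons f fs)
      then have "f \<in> arcs E" "tail E f = v" "path_ge E (head E f) u"
        using es path_ge_iff by (auto simp: awalk_Cons_iff)
      then show ?thesis using m(3) \<open>u \<in> M\<close> v(2) by (auto simp: edges_into_from_def)
    qed (use es in \<open>auto simp: awalk_Nil_iff\<close>)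
  qed
  have "u \<in> tail_of E G act (FinPath (vertex v)) \<longleftrightarrow> u \<in> M" for u
  proof
    assume "u \<in> tail_of E G act (FinPath (vertex v))"
    then show "u \<in> M" using tail_of_end_orbit[OF b e] m(2,3) v(1) unfolding invariant_def by blast
  next
    assume "u \<in> M"
    then show "u \<in> tail_of E G act (FinPath (vertex v))"
      using m(5)[OF v(1)] stop tail_of_end_orbit[OF b e] by metis
  qed
  then have T: "tail_of E G act (FinPath (vertex v)) = M" by blast
  have "v \<notin> breaking_vertices E G act" using breaking_iff[OF b e] v(2) T by blast
  then show "quasi_orbit_label (FinPath (vertex v)) = Inl M"
    using T by (auto simp: quasi_orbit_label_def ends_breaking_def fsource_vertex)
  have "path_ge E v v" using path_ge_refl s singular_iff by blast
  then show "minimal_in E M v" using stop v(1) unfolding minimal_in_def path_equiv_def by blast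
qed

lemma InfPath_label: "quasi_orbit_label (InfPath x) = Inl (tail_of E G act (InfPath x))"
  by (simp add: quasi_orbit_label_def ends_breaking_def)

text \<open>
  A path that starts at a vertex of \<open>x\<close> and ends in \<open>M\<close> stays in \<open>M\<close>, so it has to follow \<open>x\<close>.  By
  directedness every vertex of \<open>M\<close> dominates a translate of the end of such a path.
\<close>
lemma tail_of_no_entry:
  assumes M: "M \<in> maximal_tails E G act" and x: "x \<in> infinite_paths E"
    and "vertices_in E M x" "no_entry_in E M x"
  shows "tail_of E G act (InfPath x) = M"
proof
  note m = maximal_tailD[OF M]
  have b: "InfPath x \<in> boundary E" using x by simp
  show "tail_of E G act (InfPath x) \<subseteq> M"
    using tail_of_least[OF b _ m(2,3)] assms(3) by (simp add: vertices_in_def)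
  have follow: "u = tail E (x !! (k + length es))" if "awalk (tail E (x !! k)) es u" "u \<in> M" for es u k
    using that
  proof (induction es arbitrary: k)
    case (Cons e es)
    then have e: "e \<in> arcs E" "tail E e = tail E (x !! k)" "awalk (head E e) es u"
      by (auto simp: awalk_Cons_iff)
    then have "head E e \<in> M" using m(3) Cons.prems(2) path_ge_iff by blast
    then have "e \<in> edges_into_from E (tail E (x !! k)) M" using e by (simp add: edges_into_from_def)
    then have "e = x !! k" using assms(4) unfolding no_entry_in_def by blast
    then have "head E e = tail E (x !! Suc k)" using x unfolding infinite_paths_def by blast
    then show ?case using Cons.IH[of "Suc k"] e(3) Cons.prems(2) by simp
  qed (auto simp: awalk_Nil_iff)
  show "M \<subseteq> tail_of E G act (InfPath x)"
  proof
    fix w assume "w \<in> M"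
    moreover have "tail E (x !! 0) \<in> M" using assms(3) unfolding vertices_in_def by blast
    ultimately obtain g u where g: "g \<in> carrier G" "u \<in> M" "path_ge E (tail E (x !! 0)) u" "path_ge E w (vact act g u)"
      using m(5) by meson
    then obtain n where "u = tail E (x !! n)" using follow[of 0] path_ge_iff by blast
    then show "w \<in> tail_of E G act (InfPath x)"
      using g tail_of_iff[OF b] by (metis enat_ord_code(3) plength.simps(2) pvert_InfPath)
  qed
qed

end

section \<open>Generic paths\<close>

text \<open>
  A Baire category argument for words: if every admissible word can be prolonged to an admissible word
  with any one of countably many properties, then these properties can be met one after the other along
  a single infinite word.
\<close>
lemma generic_stream:
  assumes "countable \<P>" "\<P> \<noteq> {}" "S []"
    and dense: "\<And>P a. P \<in> \<P> \<Longrightarrow> S a \<Longrightarrow> \<exists>b. b \<noteq> [] \<and> S (a @ b) \<and> P (a @ b)"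
  obtains x where "\<And>n. \<exists>k\<ge>n. S (stake k x)" "\<And>P. P \<in> \<P> \<Longrightarrow> \<exists>k. P (stake k x)"
proof -
  define e where "e = from_nat_into \<P>"
  have e: "e n \<in> \<P>" for n unfolding e_def using from_nat_into assms(2) by metis
  have "\<exists>f. \<forall>n. S (f n) \<and> (\<exists>b. b \<noteq> [] \<and> f (Suc n) = f n @ b \<and> e n (f (Suc n)))"
  proof (rule dependent_nat_choice)
    show "\<exists>a. S a" using assms(3) by blast
    show "\<exists>a'. S a' \<and> (\<exists>b. b \<noteq> [] \<and> a' = a @ b \<and> e n a')" if "S a" for a n
      using dense[OF e that] by blast
  qed
  then obtain f where f: "\<And>n. S (f n)" "\<And>n. \<exists>b. b \<noteq> [] \<and> f (Suc n) = f n @ b" "\<And>n. e n (f (Suc n))"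
    by blast
  have len: "n \<le> length (f n)" for n
  proof (induction n)
    case (Suc n)
    obtain b where "b \<noteq> []" "f (Suc n) = f n @ b" using f(2) by blast
    then show ?case using Suc by (cases b) auto
  qed simp
  have pre: "\<exists>b. f m = f n @ b" if "n \<le> m" for m n
    using that
  proof (induction rule: dec_induct)
    case (step k)
    then show ?case using f(2)[of k] by auto
  qed simp
  \<comment> \<open>The word \<open>f (Suc i)\<close> has length greater than \<open>i\<close>, so its letter at \<open>i\<close> is final.\<close>
  define x where "x = smap (\<lambda>i. f (Suc i) ! i) nats"
  have st: "stake (length (f n)) x = f n" for n
  proof (rule nth_equalityI)
    fix i assume "i < length (stake (length (f n)) x)"
    then have i: "i < length (f n)" by simp
    have i': "i < length (f (Suc i))" using len[of "Suc i"] by simp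
    have "f (Suc i) ! i = f n ! i"
      using pre[of n "Suc i"] pre[of "Suc i" n] i i' by (metis nat_le_linear nth_append)
    then show "stake (length (f n)) x ! i = f n ! i" using i by (simp add: x_def)
  qed simp
  have "\<exists>k. P (stake k x)" if P: "P \<in> \<P>" for P
  proof -
    obtain n where "P = e n" unfolding e_def using from_nat_into_surj[OF assms(1) P] by metis
    then show ?thesis using f(3)[of n] st by metis
  qed
  moreover have "\<exists>k\<ge>n. S (stake k x)" for n using len st f(1) by metis
  ultimately show thesis using that by blast
qed

context self_similar_graph
begin

text \<open>
  The admissible words are the paths from \<open>v\<close> that end in \<open>M\<close>; since \<open>M\<close> is closed under passing to
  dominating vertices, all vertices of the resulting infinite path lie in \<open>M\<close>.
\<close>
lemma generic_path:
  assumes her: "\<And>v w. path_ge E v w \<Longrightarrow> w \<in> M \<Longrightarrow> v \<in> M" and M: "M \<subseteq> verts E" and v: "v \<in> M"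
    and "countable \<P>" "\<P> \<noteq> {}"
    and dense: "\<And>P a u. P \<in> \<P> \<Longrightarrow> awalk v a u \<Longrightarrow> u \<in> M \<Longrightarrow>
      \<exists>b w. b \<noteq> [] \<and> awalk u b w \<and> w \<in> M \<and> P (a @ b)"
  shows "\<exists>x \<in> infinite_paths E. vertices_in E M x \<and> (\<forall>k. awalk v (stake k x) (tail E (x !! k))) \<and>
    (\<forall>P \<in> \<P>. \<exists>k. P (stake k x))"
proof -
  obtain x where x: "\<And>n. \<exists>k\<ge>n. \<exists>w\<in>M. awalk v (stake k x) w" "\<And>P. P \<in> \<P> \<Longrightarrow> \<exists>k. P (stake k x)"
  proof (rule generic_stream[where S = "\<lambda>a. \<exists>w\<in>M. awalk v a w", OF assms(4,5)])
    show "\<exists>w\<in>M. awalk v [] w" using v M by (auto simp: awalk_Nil_iff)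
    show "\<exists>b. b \<noteq> [] \<and> (\<exists>w\<in>M. awalk v (a @ b) w) \<and> P (a @ b)"
      if "P \<in> \<P>" "\<exists>w\<in>M. awalk v a w" for P a
      using dense[OF that(1)] that(2) awalk_appendI by meson
  qed blast
  have pre: "\<exists>w\<in>M. awalk v (stake n x) w" for n
  proof -
    obtain k w where k: "k \<ge> n" "w \<in> M" "awalk v (stake k x) w" using x(1) by blast
    have "take n (stake k x) = stake n x" using k(1) by (simp add: take_stake min_def)
    then show ?thesis using awalk_split[OF k(3), of n] her k(2) path_ge_iff by metis
  qed
  then have xi: "x \<in> infinite_paths E" and aw: "awalk v (stake n x) (tail E (x !! n))" for n
    by (meson infinite_pathI)+
  have "tail E (x !! n) \<in> M" for n using pre[of n] aw[of n] by auto
  then show ?thesis using xi aw x(2) unfolding vertices_in_def by blast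
qed

lemma sdrop_infinite_paths: "x \<in> infinite_paths E \<Longrightarrow> sdrop n x \<in> infinite_paths E"
  using boundary_split[of "InfPath x" n] by (simp add: shift1_pow_InfPath)

text \<open>
  If \<open>\<sigma>\<^sup>n(x) = g\<cdot>\<sigma>\<^sup>m(x)\<close> with \<open>n \<noteq> m\<close>, an initial segment of \<open>x\<close> of length greater than \<open>n\<close> and \<open>m\<close> determines
  \<open>x\<close>: each later edge is obtained from earlier ones by applying \<open>g\<close> or, in the other direction, by the
  injectivity of the action of \<open>g\<close>.
\<close>
lemma periodic_path_determined:
  assumes x: "x \<in> infinite_paths E" and y: "y \<in> infinite_paths E" and g: "g \<in> carrier G" and "n \<noteq> m"
    and px: "InfPath (sdrop n x) = pact E act g (InfPath (sdrop m x))"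
    and py: "InfPath (sdrop n y) = pact E act g (InfPath (sdrop m y))"
    and "n < N" "m < N" and pre: "stake N x = stake N y"
  shows "x = y"
proof -
  have nth: "x !! i = y !! i" if "i < N" for i using pre that by (metis stake_nth)
  have sx: "stake j (sdrop n x) = edges_act g (tail E (x !! m)) (stake j (sdrop m x))" for j
    using pact_InfPath[OF g sdrop_infinite_paths[OF x, of m]] px[symmetric] by (metis add_0_right path.inject(2) sdrop_snth)
  have sy: "stake j (sdrop n y) = edges_act g (tail E (x !! m)) (stake j (sdrop m y))" for j
    using pact_InfPath[OF g sdrop_infinite_paths[OF y, of m]] py[symmetric] nth[OF assms(8)]
    by (metis add_0_right path.inject(2) sdrop_snth)
  have ax: "awalk (tail E (x !! m)) (stake j (sdrop m x)) (tail E (sdrop m x !! j))" for j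
    using infinite_path_awalk[OF sdrop_infinite_paths[OF x], of m j] by (simp add: sdrop_snth)
  have ay: "awalk (tail E (x !! m)) (stake j (sdrop m y)) (tail E (sdrop m y !! j))" for j
    using infinite_path_awalk[OF sdrop_infinite_paths[OF y], of m j] nth[OF assms(8)] by (simp add: sdrop_snth)
  have iff: "stake j (sdrop n x) = stake j (sdrop n y) \<longleftrightarrow> stake j (sdrop m x) = stake j (sdrop m y)" for j
    unfolding sx sy using edges_act_inj[OF g ax ay] by metis
  have seg: "stake j (sdrop l x) = stake j (sdrop l y) \<longleftrightarrow> (\<forall>i<j. x !! (l + i) = y !! (l + i))" for j l
    by (simp add: list_eq_iff_nth_eq sdrop_snth)
  define a b where "a = min n m" and "b = max n m"
  have ab: "a < b" "b < N" using assms(4,7,8) by (auto simp: a_def b_def)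
  have swap: "(\<forall>i<j. x !! (a + i) = y !! (a + i)) \<longleftrightarrow> (\<forall>i<j. x !! (b + i) = y !! (b + i))" for j
    using iff[of j] unfolding seg a_def b_def by (cases "n \<le> m") (simp_all add: min_def max_def)
  have "x !! k = y !! k" for k
  proof (induction k rule: less_induct)
    case (less k)
    show ?case
    proof (cases "k < N")
      case False
      then have "\<forall>i < Suc (k - b). x !! (a + i) = y !! (a + i)" using less ab by simp
      then have "x !! (b + (k - b)) = y !! (b + (k - b))" unfolding swap by blast
      then show ?thesis using False ab by simp
    qed (use nth in blast)
  qed
  then show ?thesis using smap_alt[of id x y] by (simp add: stream.map_id)
qed

end

context countable_self_similar_graph
begin

text \<open>
  If some infinite path in \<open>M\<close> has no entry, it is aperiodic because \<open>M\<close> does not lie in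
  \<open>\<L>(G,E)\<close>, and its tail is \<open>M\<close>.  Otherwise from every vertex of \<open>M\<close> there is a path
  to some \<open>u\<close> with two different edges in \<open>uE\<^sup>1M\<close>, and a generic path works.
  There are two countable families of requirements: every
  vertex of \<open>M\<close> dominates a translate of a vertex of \<open>x\<close>, and \<open>\<sigma>\<^sup>n(x) \<noteq> g\<cdot>\<sigma>\<^sup>k(x)\<close> for all \<open>g\<close> and \<open>n \<noteq> k\<close>.
  The first can be met by directedness.  For the second, prolong a given path beyond length \<open>max n k\<close>
  and then to a branching vertex: of the two continuations at most one has an infinite prolongation that
  violates the requirement, since such a prolongation is determined by the part before the branching.
\<close>
lemma aperiodic_realisation:
  assumes M: "M \<in> maximal_tails E G act" and "M \<notin> tails_L E G act"
    and ne: "\<And>v. v \<in> M \<Longrightarrow> edges_into_from E v M \<noteq> {}"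
  shows "\<exists>x \<in> infinite_paths E. tail_of E G act (InfPath x) = M \<and> InfPath x \<in> aperiodic_paths E G act"
proof (cases "\<exists>x \<in> infinite_paths E. vertices_in E M x \<and> no_entry_in E M x")
  case True
  then obtain x where x: "x \<in> infinite_paths E" "vertices_in E M x" "no_entry_in E M x" by blast
  then have "InfPath x \<in> aperiodic_paths E G act"
    using assms(1,2) unfolding tails_L_def loop_paths_def by blast
  then show ?thesis using tail_of_no_entry[OF M x] x(1) by blast
next
  case False
  note m = maximal_tailD[OF M]
  have MV: "M \<subseteq> verts E" using m(2) unfolding invariant_def by blast
  have step: "\<exists>w \<in> M. awalk v [e] w" if "e \<in> edges_into_from E v M" for e v
    using that arc_implies_awalk unfolding edges_into_from_def by blast
  have extend: "\<exists>b w. b \<noteq> [] \<and> awalk u b w \<and> w \<in> M" if "u \<in> M" for u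
    using ne[OF that] step by blast
  have path: "\<exists>x \<in> infinite_paths E. vertices_in E M x \<and> (\<forall>k. awalk v (stake k x) (tail E (x !! k)))"
    if v: "v \<in> M" for v
  proof -
    have "\<exists>x \<in> infinite_paths E. vertices_in E M x \<and> (\<forall>k. awalk v (stake k x) (tail E (x !! k))) \<and>
        (\<forall>P \<in> {\<lambda>_. True}. \<exists>k. P (stake k x))"
      by (rule generic_path[OF m(3) MV v]) (use extend in auto)
    then show ?thesis by blast
  qed
  have long: "\<exists>b w. length b = N \<and> awalk v b w \<and> w \<in> M" if v: "v \<in> M" for v N
  proof -
    obtain x where "\<And>k. tail E (x !! k) \<in> M" "\<And>k. awalk v (stake k x) (tail E (x !! k))"
      using path[OF v] unfolding vertices_in_def by blast
    then show ?thesis by (metis length_stake)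
  qed
  have branch: "\<exists>b u e f. awalk v b u \<and> e \<in> edges_into_from E u M \<and> f \<in> edges_into_from E u M \<and> e \<noteq> f"
    if v: "v \<in> M" for v
  proof (rule ccontr)
    assume no: "\<not> ?thesis"
    obtain x where x: "x \<in> infinite_paths E" "vertices_in E M x" "\<And>k. awalk v (stake k x) (tail E (x !! k))"
      using path[OF v] by blast
    have "x !! n \<in> arcs E \<and> head E (x !! n) = tail E (x !! Suc n)" for n
      using x(1) unfolding infinite_paths_def by blast
    then have "x !! n \<in> edges_into_from E (tail E (x !! n)) M" for n
      using x(2) unfolding edges_into_from_def vertices_in_def by (simp del: snth.simps)
    then have "edges_into_from E (tail E (x !! n)) M = {x !! n}" for n
      using no x(3)[of n] by blast
    then show False using False x(1,2) unfolding no_entry_in_def by blast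
  qed
  obtain v where v: "v \<in> M" using m(1) by blast
  \<comment> \<open>The two families of requirements.  An infinite path meets a requirement as soon as one of its
    initial segments does.\<close>
  define reaches where "reaches w a \<longleftrightarrow> (\<exists>g \<in> carrier G. \<exists>u. awalk v a u \<and> path_ge E w (vact act g u))" for w a
  define avoids where "avoids t a \<longleftrightarrow> (case t of (g, n, k) \<Rightarrow> \<forall>x \<in> infinite_paths E. stake (length a) x = a \<longrightarrow>
      InfPath (sdrop n x) \<noteq> pact E act g (InfPath (sdrop k x)))" for t a
  define T where "T = {(g, n, k). g \<in> carrier G \<and> (n :: nat) \<noteq> k}"
  define \<P> where "\<P> = insert (\<lambda>_. True) (reaches ` M \<union> avoids ` T)"
  have "countable M" "countable T"
  proof -
    have c: "countable (carrier G)" "countable (verts E)"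
      using countable_self_similar_graph_axioms
      unfolding countable_self_similar_graph_def countable_self_similar_graph_axioms_def by auto
    show "countable M" using c(2) MV countable_subset by blast
    have "T \<subseteq> carrier G \<times> UNIV \<times> UNIV" unfolding T_def by blast
    then show "countable T" using c(1) countable_subset by (metis countable_SIGMA countableI_type)
  qed
  then have cP: "countable \<P>" unfolding \<P>_def by blast
  have dense_reaches: "\<exists>b w'. b \<noteq> [] \<and> awalk u b w' \<and> w' \<in> M \<and> reaches w (a @ b)"
    if w: "w \<in> M" and a: "awalk v a u" "u \<in> M" for w a u
  proof -
    obtain g u1 where g: "g \<in> carrier G" "u1 \<in> M" "path_ge E u u1" "path_ge E w (vact act g u1)"
      using m(5)[OF a(2) w] by blast
    obtain b where b: "awalk u b u1" using g(3) path_ge_iff by blast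
    obtain c u2 where c: "c \<noteq> []" "awalk u1 c u2" "u2 \<in> M" using extend[OF g(2)] by blast
    have "path_ge E w (vact act g u2)"
      using g(4) path_ge_vact[OF g(1)] c(2) path_ge_iff path_ge_trans by meson
    moreover have bc: "awalk u (b @ c) u2" using b c(2) by (rule awalk_appendI)
    moreover have "awalk v (a @ (b @ c)) u2" using a(1) bc by (rule awalk_appendI)
    ultimately show ?thesis using c(1,3) g(1) unfolding reaches_def by (intro exI[of _ "b @ c"] exI[of _ u2]) auto
  qed
  have dense_avoids: "\<exists>b w. b \<noteq> [] \<and> awalk u b w \<and> w \<in> M \<and> avoids t (a @ b)"
    if t: "t \<in> T" and a: "awalk v a u" "u \<in> M" for t a u
  proof -
    obtain g n k where t': "t = (g, n, k)" "g \<in> carrier G" "n \<noteq> k" using t unfolding T_def by blast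
    obtain b u1 where b: "length b = Suc (max n k)" "awalk u b u1" "u1 \<in> M" using long[OF a(2)] by blast
    obtain c u2 e f where c: "awalk u1 c u2" "e \<in> edges_into_from E u2 M" "f \<in> edges_into_from E u2 M" "e \<noteq> f"
      using branch[OF b(3)] by blast
    have "avoids t (a @ b @ c @ [e]) \<or> avoids t (a @ b @ c @ [f])"
    proof (rule ccontr)
      assume "\<not> ?thesis"
      then obtain x y where xy: "x \<in> infinite_paths E" "stake (length (a @ b @ c @ [e])) x = a @ b @ c @ [e]"
        "InfPath (sdrop n x) = pact E act g (InfPath (sdrop k x))"
        "y \<in> infinite_paths E" "stake (length (a @ b @ c @ [f])) y = a @ b @ c @ [f]"
        "InfPath (sdrop n y) = pact E act g (InfPath (sdrop k y))"
        unfolding avoids_def t' prod.case by blast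
      let ?N = "length (a @ b @ c)"
      have st: "stake (Suc ?N) x = (a @ b @ c) @ [e]" "stake (Suc ?N) y = (a @ b @ c) @ [f]"
        using xy(2,5) by simp_all
      then have "stake ?N x = stake ?N y" "x !! ?N = e" "y !! ?N = f"
        unfolding stake_Suc_snoc append1_eq_conv by (simp_all only:)
      moreover have "n < ?N" "k < ?N" using b(1) by auto
      ultimately show False
        using periodic_path_determined[OF xy(1,4) t'(2,3) xy(3,6)] c(4) by blast
    qed
    then obtain d where d: "d \<in> edges_into_from E u2 M" "avoids t (a @ b @ c @ [d])" using c(2,3) by blast
    obtain w where w: "w \<in> M" "awalk u2 [d] w" using step[OF d(1)] by blast
    have "awalk u (b @ c @ [d]) w" using b(2) c(1) w(2) by (meson awalk_appendI)
    then show ?thesis using w(1) d(2) by (intro exI[of _ "b @ c @ [d]"] exI[of _ w]) auto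
  qed
  have "\<P> \<noteq> {}" unfolding \<P>_def by blast
  have dense: "\<exists>b w. b \<noteq> [] \<and> awalk u b w \<and> w \<in> M \<and> P (a @ b)"
    if "P \<in> \<P>" and a: "awalk v a u" "u \<in> M" for P a u
  proof -
    from that(1) consider "P = (\<lambda>_. True)" | w where "w \<in> M" "P = reaches w" | t where "t \<in> T" "P = avoids t"
      unfolding \<P>_def by blast
    then show ?thesis
    proof cases
      case 1
      then show ?thesis using extend[OF a(2)] by simp
    next
      case (2 w)
      then show ?thesis using dense_reaches[OF _ a] by simp
    next
      case (3 t)
      then show ?thesis using dense_avoids[OF _ a] by simp
    qed
  qed
  have "\<exists>x \<in> infinite_paths E. vertices_in E M x \<and> (\<forall>k. awalk v (stake k x) (tail E (x !! k))) \<and>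
      (\<forall>P \<in> \<P>. \<exists>k. P (stake k x))"
    by (rule generic_path[OF m(3) MV v cP \<open>\<P> \<noteq> {}\<close> dense])
  then obtain x where x: "x \<in> infinite_paths E" "vertices_in E M x" "\<And>k. awalk v (stake k x) (tail E (x !! k))"
    and P: "\<And>P. P \<in> \<P> \<Longrightarrow> \<exists>k. P (stake k x)"
    by blast
  have xb: "InfPath x \<in> boundary E" using x(1) by simp
  have "tail_of E G act (InfPath x) = M"
  proof
    show "tail_of E G act (InfPath x) \<subseteq> M"
      using tail_of_least[OF xb _ m(2,3)] x(2) by (simp add: vertices_in_def)
    show "M \<subseteq> tail_of E G act (InfPath x)"
    proof
      fix w assume "w \<in> M"
      then obtain k where "reaches w (stake k x)" using P[of "reaches w"] unfolding \<P>_def by blast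
      then obtain g u where g: "g \<in> carrier G" "awalk v (stake k x) u" "path_ge E w (vact act g u)"
        unfolding reaches_def by blast
      then have "u = pvert E (InfPath x) k" using x(3)[of k] by auto
      then show "w \<in> tail_of E G act (InfPath x)" using g(1,3) tail_of_iff[OF xb] by auto
    qed
  qed
  moreover have "InfPath x \<in> aperiodic_paths E G act"
    unfolding aperiodic_paths_def
  proof (intro CollectI conjI ballI allI impI)
    fix g n k
    assume g: "g \<in> carrier G" and eq: "(shift1 E ^^ n) (InfPath x) = pact E act g ((shift1 E ^^ k) (InfPath x))"
    show "n = k"
    proof (rule ccontr)
      assume "n \<noteq> k"
      then have "(g, n, k) \<in> T" using g unfolding T_def by blast
      then obtain j where "avoids (g, n, k) (stake j x)" using P[of "avoids (g, n, k)"] unfolding \<P>_def by blast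
      then show False using x(1) eq unfolding avoids_def shift1_pow_InfPath by simp
    qed
  qed (rule xb)
  ultimately show ?thesis using x(1) by blast
qed

lemma tails_infty_realised:
  assumes "M \<in> tails_infty E G act"
  shows "\<exists>x \<in> infinite_paths E. tail_of E G act (InfPath x) = M \<and> InfPath x \<in> aperiodic_paths E G act"
  using assms sink_in_tail(3) unfolding tails_infty_def tails_gamma_def tails_0_def
  by (intro aperiodic_realisation) blast+

section \<open>The bijection\<close>

lemma quasi_orbit_eq:
  "x \<in> boundary E \<Longrightarrow> quasi_orbit E G act x = {y \<in> boundary E. quasi_orbit_label y = quasi_orbit_label x}"
  unfolding quasi_orbit_def quasi_orbit_rel_def using quasi_orbit_label_eq_iff by auto

lemma quasi_orbit_eq_iff:
  assumes "x \<in> boundary E" "y \<in> boundary E"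
  shows "quasi_orbit E G act x = quasi_orbit E G act y \<longleftrightarrow> quasi_orbit_label x = quasi_orbit_label y"
  using assms quasi_orbit_eq by auto

lemma quasi_orbit_space_eq: "quasi_orbit_space E G act = quasi_orbit E G act ` boundary E"
  unfolding quasi_orbit_space_def quotient_def quasi_orbit_def by blast

lemma label_breaking:
  assumes "fsource E p \<in> breaking_vertices E G act"
  shows "quasi_orbit_label (FinPath p) = Inr (orbit G (vact act) (fsource E p))"
  using assms by (auto simp: quasi_orbit_label_def ends_breaking_def end_orbit_FinPath)

lemma breaking_vertex_boundary: "v \<in> breaking_vertices E G act \<Longrightarrow> FinPath (vertex v) \<in> boundary E"
  by (rule vertex_boundary) (simp add: breaking_vertices_def)

lemma loop_path_label:
  assumes "L \<in> tails_L E G act" "x \<in> loop_paths E G act L"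
  shows "InfPath x \<in> boundary E" "quasi_orbit_label (InfPath x) = Inl L"
  using assms tail_of_no_entry[of L x] InfPath_label unfolding tails_L_def loop_paths_def by auto

lemma label_in:
  assumes "x \<in> boundary E"
  shows "quasi_orbit_label x \<in> tails_and_breaking_orbits E G act"
proof (cases "ends_breaking x")
  case True
  then obtain p where "x = FinPath p" "fsource E p \<in> breaking_vertices E G act"
    unfolding ends_breaking_def by blast
  then show ?thesis using label_breaking unfolding tails_and_breaking_orbits_def orbits_def by auto
next
  case False
  then show ?thesis using tail_of_maximal[OF assms]
    unfolding tails_and_breaking_orbits_def quasi_orbit_label_def by (simp add: InlI)
qed

text \<open>
  The conditions imposed on the bijection besides bijectivity.  The existence of an aperiodic path in
  the clause for \<open>\<M>\<^sub>\<infinity>(G,E)\<close> does not involve \<open>\<pi>\<close>; it guarantees that this clause determines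
  \<open>\<pi>(M)\<close>.
\<close>
definition characterising_clauses :: "('a set \<Rightarrow> 'b stream) \<Rightarrow> ('a set + 'a set \<Rightarrow> ('a, 'b) path set) \<Rightarrow> bool" where
  "characterising_clauses xL \<pi> \<longleftrightarrow>
     (\<forall>L \<in> tails_L E G act. \<pi> (Inl L) = quasi_orbit E G act (InfPath (xL L))) \<and>
     (\<forall>M \<in> tails_0 E G act. \<forall>v. minimal_in E M v \<and> edges_into_from E v M = {} \<longrightarrow>
        v \<in> singular_vertices E \<and> \<pi> (Inl M) = quasi_orbit E G act (FinPath (vertex v))) \<and>
     (\<forall>M \<in> tails_infty E G act.
        (\<forall>x \<in> infinite_paths E. tail_of E G act (InfPath x) = M \<longrightarrow>
           \<pi> (Inl M) = quasi_orbit E G act (InfPath x)) \<and>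
        (\<exists>x \<in> infinite_paths E. tail_of E G act (InfPath x) = M \<and>
           InfPath x \<in> aperiodic_paths E G act)) \<and>
     (\<forall>v \<in> breaking_vertices E G act.
        \<pi> (Inr (orbit G (vact act) v)) = quasi_orbit E G act (FinPath (vertex v)))"

text \<open>
  Every element of the domain is covered by one of the clauses, and the path used in that clause has
  this element as its label.
\<close>
lemma clauses_representative:
  assumes xL: "\<And>L. L \<in> tails_L E G act \<Longrightarrow> xL L \<in> loop_paths E G act L"
    and \<pi>: "characterising_clauses xL \<pi>" and d: "d \<in> tails_and_breaking_orbits E G act"
  obtains x where "x \<in> boundary E" "quasi_orbit_label x = d" "\<pi> d = quasi_orbit E G act x"
proof -
  note c = \<pi>[unfolded characterising_clauses_def]
  note c\<^sub>L = conjunct1[OF c] and c\<^sub>0 = conjunct1[OF conjunct2[OF c]]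
    and c_infty = conjunct1[OF conjunct2[OF conjunct2[OF c]]]
    and c_brk = conjunct2[OF conjunct2[OF conjunct2[OF c]]]
  consider (brk) v where "v \<in> breaking_vertices E G act" "d = Inr (orbit G (vact act) v)"
    | (L) M where "M \<in> tails_L E G act" "d = Inl M"
    | (zero) M v where "M \<in> tails_0 E G act" "M \<in> maximal_tails E G act" "minimal_in E M v"
        "edges_into_from E v M = {}" "d = Inl M"
    | (infty) M where "M \<in> tails_infty E G act" "d = Inl M"
    using d unfolding tails_and_breaking_orbits_def orbits_def tails_infty_def tails_gamma_def tails_0_def
    by blast
  then show thesis
  proof cases
    case (brk v)
    then show ?thesis
      using that[of "FinPath (vertex v)"] c_brk breaking_vertex_boundary label_breaking[of "vertex v"]
      by (simp add: fsource_vertex)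
  next
    case (L M)
    then show ?thesis using that[of "InfPath (xL M)"] c\<^sub>L loop_path_label xL by metis
  next
    case (zero M v)
    then have "v \<in> M" unfolding minimal_in_def by blast
    note s = sink_in_tail[OF zero(2) this zero(4)]
    show ?thesis
      by (rule that[OF vertex_boundary[OF s(1)]]) (use s(2) zero c\<^sub>0 in auto)
  next
    case (infty M)
    then obtain x where x: "x \<in> infinite_paths E" "tail_of E G act (InfPath x) = M"
      using tails_infty_realised by blast
    then have "\<pi> (Inl M) = quasi_orbit E G act (InfPath x)" using c_infty infty(1) by metis
    then show ?thesis using that[of "InfPath x"] infty(2) x InfPath_label by auto
  qed
qed

text \<open>
  The clauses are a redundant way to say that \<open>\<pi>\<close> sends the label of every boundary path to its
  quasi-orbit.  As labels are complete invariants of quasi-orbits, overlaps between the clauses are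
  harmless.
\<close>
theorem characterising_clauses_iff:
  assumes xL: "\<And>L. L \<in> tails_L E G act \<Longrightarrow> xL L \<in> loop_paths E G act L"
  shows "characterising_clauses xL \<pi> \<longleftrightarrow> (\<forall>x \<in> boundary E. \<pi> (quasi_orbit_label x) = quasi_orbit E G act x)"
proof
  assume \<pi>: "characterising_clauses xL \<pi>"
  show "\<forall>x \<in> boundary E. \<pi> (quasi_orbit_label x) = quasi_orbit E G act x"
  proof
    fix x assume x: "x \<in> boundary E"
    obtain y where "y \<in> boundary E" "quasi_orbit_label y = quasi_orbit_label x"
      "\<pi> (quasi_orbit_label x) = quasi_orbit E G act y"
      by (rule clauses_representative[OF xL \<pi> label_in[OF x]])
    then show "\<pi> (quasi_orbit_label x) = quasi_orbit E G act x" using quasi_orbit_eq_iff x by simp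
  qed
next
  assume \<pi>: "\<forall>x \<in> boundary E. \<pi> (quasi_orbit_label x) = quasi_orbit E G act x"
  show "characterising_clauses xL \<pi>"
    unfolding characterising_clauses_def
  proof (intro conjI ballI allI impI)
    fix L assume "L \<in> tails_L E G act"
    then show "\<pi> (Inl L) = quasi_orbit E G act (InfPath (xL L))" using loop_path_label[OF _ xL] \<pi> by metis
  next
    fix M v assume "M \<in> tails_0 E G act" and v: "minimal_in E M v \<and> edges_into_from E v M = {}"
    then have "M \<in> maximal_tails E G act" "v \<in> M" unfolding tails_0_def minimal_in_def by blast+
    note s = sink_in_tail[OF this conjunct2[OF v]]
    show "v \<in> singular_vertices E" by (rule s)
    show "\<pi> (Inl M) = quasi_orbit E G act (FinPath (vertex v))"
      using \<pi> s(2) vertex_boundary[OF s(1)] by metis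
  next
    fix M x assume "x \<in> infinite_paths E" "tail_of E G act (InfPath x) = M"
    then show "\<pi> (Inl M) = quasi_orbit E G act (InfPath x)" using \<pi> InfPath_label InfPath_boundary_iff by metis
  next
    fix M assume "M \<in> tails_infty E G act"
    then show "\<exists>x \<in> infinite_paths E. tail_of E G act (InfPath x) = M \<and> InfPath x \<in> aperiodic_paths E G act"
      by (rule tails_infty_realised)
  next
    fix v assume v: "v \<in> breaking_vertices E G act"
    then show "\<pi> (Inr (orbit G (vact act) v)) = quasi_orbit E G act (FinPath (vertex v))"
      using \<pi> breaking_vertex_boundary[OF v] label_breaking[of "vertex v"] fsource_vertex by metis
  qed
qed

lemma clauses_satisfiable:
  "\<exists>\<pi>. \<pi> \<in> extensional (tails_and_breaking_orbits E G act) \<and>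
     (\<forall>x \<in> boundary E. \<pi> (quasi_orbit_label x) = quasi_orbit E G act x)"
proof -
  let ?\<pi> = "restrict (\<lambda>d. {y \<in> boundary E. quasi_orbit_label y = d}) (tails_and_breaking_orbits E G act)"
  show ?thesis
  proof (intro exI[of _ ?\<pi>] conjI ballI restrict_extensional)
    fix x assume x: "x \<in> boundary E"
    show "?\<pi> (quasi_orbit_label x) = quasi_orbit E G act x"
      using label_in[OF x] quasi_orbit_eq[OF x] by simp
  qed
qed

lemma bijection_of_clauses:
  assumes xL: "\<And>L. L \<in> tails_L E G act \<Longrightarrow> xL L \<in> loop_paths E G act L"
    and \<pi>: "characterising_clauses xL \<pi>"
  shows "bij_betw \<pi> (tails_and_breaking_orbits E G act) (quasi_orbit_space E G act)"
    and "x \<in> boundary E \<Longrightarrow>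
      inv_into (tails_and_breaking_orbits E G act) \<pi> (quasi_orbit E G act x) = quasi_orbit_label x"
proof -
  let ?D = "tails_and_breaking_orbits E G act"
  have eq: "\<pi> (quasi_orbit_label x) = quasi_orbit E G act x" if "x \<in> boundary E" for x
    using characterising_clauses_iff[OF xL] \<pi> that by blast
  have rep: "\<exists>x \<in> boundary E. d = quasi_orbit_label x" if "d \<in> ?D" for d
    using clauses_representative[OF xL \<pi> that] by metis
  have inj: "inj_on \<pi> ?D"
    by (rule inj_onI) (metis rep eq quasi_orbit_eq_iff)
  have "\<pi> ` ?D = quasi_orbit E G act ` boundary E"
  proof
    show "\<pi> ` ?D \<subseteq> quasi_orbit E G act ` boundary E" using rep eq by blast
    show "quasi_orbit E G act ` boundary E \<subseteq> \<pi> ` ?D" using label_in eq by (metis image_eqI image_subsetI)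
  qed
  with inj show "bij_betw \<pi> ?D (quasi_orbit_space E G act)"
    unfolding bij_betw_def quasi_orbit_space_eq by blast
  show "inv_into ?D \<pi> (quasi_orbit E G act x) = quasi_orbit_label x" if "x \<in> boundary E"
    using inv_into_f_f[OF inj label_in[OF that]] eq[OF that] by simp
qed

end

theorem theorem4p24:
  fixes E :: "('v, 'e) pre_digraph"
    and G :: "('g, 'b) monoid_scheme"
    and act :: "'g \<Rightarrow> ('v, 'e) fpath \<Rightarrow> ('v, 'e) fpath"
    and restr :: "'g \<Rightarrow> ('v, 'e) fpath \<Rightarrow> 'g"
    and xL :: "'v set \<Rightarrow> 'e stream"
  assumes "countable_self_similar_graph E G act restr"
    and "\<And>L. L \<in> tails_L E G act \<Longrightarrow> xL L \<in> loop_paths E G act L"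
  shows "let D = tails_and_breaking_orbits E G act;
             Q = quasi_orbit E G act;
             P = (\<lambda>\<pi> :: 'v set + 'v set \<Rightarrow> ('v, 'e) path set.
               \<pi> \<in> extensional D \<and> bij_betw \<pi> D (quasi_orbit_space E G act) \<and>
               (\<forall>L \<in> tails_L E G act. \<pi> (Inl L) = Q (InfPath (xL L))) \<and>
               (\<forall>M \<in> tails_0 E G act. \<forall>v. minimal_in E M v \<and> edges_into_from E v M = {} \<longrightarrow>
                  v \<in> singular_vertices E \<and> \<pi> (Inl M) = Q (FinPath (vertex v))) \<and>
               (\<forall>M \<in> tails_infty E G act.
                  (\<forall>x \<in> infinite_paths E. tail_of E G act (InfPath x) = M \<longrightarrow>
                     \<pi> (Inl M) = Q (InfPath x)) \<and>
                  (\<exists>x \<in> infinite_paths E. tail_of E G act (InfPath x) = M \<and>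
                     InfPath x \<in> aperiodic_paths E G act)) \<and>
               (\<forall>v \<in> breaking_vertices E G act.
                  \<pi> (Inr (orbit G (vact act) v)) = Q (FinPath (vertex v))))
         in (\<exists>!\<pi>. P \<pi>) \<and>
            (\<forall>\<pi>. P \<pi> \<longrightarrow>
               (\<forall>p. FinPath p \<in> boundary E \<and> fsource E p \<in> breaking_vertices E G act \<longrightarrow>
                  inv_into D \<pi> (Q (FinPath p)) = Inr (orbit G (vact act) (fsource E p))) \<and>
               (\<forall>x \<in> boundary E.
                  \<not> (\<exists>p. x = FinPath p \<and> fsource E p \<in> breaking_vertices E G act) \<longrightarrow>
                  inv_into D \<pi> (Q x) = Inl (tail_of E G act x)))"
proof -
  interpret countable_self_similar_graph E G act restr by (rule assms(1))
  define D where "D = tails_and_breaking_orbits E G act"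
  define P where "P \<pi> \<longleftrightarrow> \<pi> \<in> extensional D \<and> bij_betw \<pi> D (quasi_orbit_space E G act) \<and>
     characterising_clauses xL \<pi>" for \<pi>
  have clauses: "characterising_clauses xL \<pi> \<longleftrightarrow>
      (\<forall>x \<in> boundary E. \<pi> (quasi_orbit_label x) = quasi_orbit E G act x)" for \<pi>
    by (rule characterising_clauses_iff[OF assms(2)])
  have bij: "bij_betw \<pi> D (quasi_orbit_space E G act)" if "characterising_clauses xL \<pi>" for \<pi>
    unfolding D_def by (rule bijection_of_clauses(1)[OF assms(2) that])
  have inverse: "inv_into D \<pi> (quasi_orbit E G act x) = quasi_orbit_label x"
    if "P \<pi>" "x \<in> boundary E" for \<pi> x
    using bijection_of_clauses(2)[OF assms(2) _ that(2)] that(1) unfolding P_def D_def by blast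
  have unique: "\<pi> = \<pi>'" if "P \<pi>" "P \<pi>'" for \<pi> \<pi>'
  proof (rule extensionalityI[of _ D])
    fix d assume d: "d \<in> D"
    have "\<pi> d \<in> quasi_orbit E G act ` boundary E"
      using that(1) d quasi_orbit_space_eq unfolding P_def bij_betw_def by blast
    then obtain x where x: "x \<in> boundary E" "\<pi> d = quasi_orbit E G act x" by blast
    have "inj_on \<pi> D" using that(1) unfolding P_def bij_betw_def by blast
    then have "d = quasi_orbit_label x" using inverse[OF that(1) x(1)] x(2) d inv_into_f_f by metis
    then show "\<pi> d = \<pi>' d" using that clauses x(1) unfolding P_def by metis
  qed (use that P_def in auto)
  have "\<exists>\<pi>. P \<pi>" using clauses_satisfiable clauses bij unfolding P_def D_def by blast
  then have ex1: "\<exists>!\<pi>. P \<pi>" using unique by blast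
  have "(\<forall>p. FinPath p \<in> boundary E \<and> fsource E p \<in> breaking_vertices E G act \<longrightarrow>
          inv_into D \<pi> (quasi_orbit E G act (FinPath p)) = Inr (orbit G (vact act) (fsource E p))) \<and>
       (\<forall>x \<in> boundary E. \<not> (\<exists>p. x = FinPath p \<and> fsource E p \<in> breaking_vertices E G act) \<longrightarrow>
          inv_into D \<pi> (quasi_orbit E G act x) = Inl (tail_of E G act x))" if "P \<pi>" for \<pi>
    using inverse[OF that] label_breaking by (auto simp: quasi_orbit_label_def ends_breaking_def)
  with ex1 show ?thesis
    unfolding P_def D_def characterising_clauses_def Let_def by blast
qed

end
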